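(* Let $d\ge1$, $\delta\in(0,\infty)$, $\alpha\in(0,1)$. Let $N=N(d,\delta,\alpha)$ be the constant in the basic estimate (E) of the context. Let $T\in[-\infty,\infty)$, $K\in(0,\infty)$ and $L_0u=a^{ij}(t)u_{x^ix^j}$, where $(a^{ij}(t))$ is a symmetric matrix depending only on $t\in(T,\infty)$ in a measurable way with $K(\delta^{ij})\ge(a^{ij}(t))\ge\delta(\delta^{ij})$ for all $t>T$. (i) If $u\in\mathcal C^{2+\alpha}(T)$ and there is an $R\in(0,\infty)$ such that $u(t,x)=0$ whenever $|x|\ge R$ and $t\ge T$ is finite, then for any finite $t\ge T$, any locally bounded, nonnegative, measurable function $c_0(t)$, and any locally bounded, $\mathbb R^d$-valued, measurable function $b_0(t)$, we have $$[u(t,\cdot)]_{2+\alpha}\le N\sup_{s>t}\big[(u_t+L_0u+b_0^iu_{x^i}-c_0u)(s,\cdot)\big]_\alpha .$$ (ii) If the coefficients of $L_0$ are independent of $t$, then for any $u\in C^{2+\alpha}$ with compact support, any constant $c_0\ge0$, and any constant vector $b_0\in\mathbb R^d$, we have $$[u]_{2+\alpha}\le N\,[L_0u+b_0^iu_{x^i}-c_0u]_\alpha .$$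
   Context: $\mathbb R^{d+1}=\{(t,x):t\in\mathbb R,\ x\in\mathbb R^d\}$; $\mathbb R^{d+1}_T=[T,\infty)\times\mathbb R^d$ if $T\in(-\infty,\infty)$, and $\mathbb R^{d+1}_{-\infty}=\mathbb R^{d+1}$. Summation over repeated indices is understood; $\delta^{ij}$ is the Kronecker symbol. Norms: $\|g\|_0=\sup_{\mathbb R^d}|g|$, $[g]_\alpha=\sup_{x\ne y}|g(x)-g(y)|/|x-y|^\alpha$, $[u]_{2+\alpha}=[D^2u]_\alpha$, $\|u\|_{2+\alpha}=\|u\|_0+\|Du\|_0+\|D^2u\|_0+[u]_{2+\alpha}$, where $Du$, $D^2u$ are the gradient and Hessian in $x$. $C^{2+\alpha}=C^{2+\alpha}(\mathbb R^d)$ is the space of real functions on $\mathbb R^d$ with $\|u\|_{2+\alpha}<\infty$. $\mathcal C^{2+\alpha}(T)$ is the set of functions $u$ on $\mathbb R^{d+1}_T$ such that: $u$ is continuous on $\mathbb R^{d+1}_T$; for each finite $t\ge T$, $u(t,\cdot)\in C^{2+\alpha}$, and $\|u(t,\cdot)\|_{2+\alpha}$ is bounded in $t$; and there is a measurable function $g$ on $\mathbb R^{d+1}_T$ such that for every $\zeta\in C_0^\infty(\mathbb R^{d+1})$ the function $\zeta g$ is bounded and $\alpha$-Hölder continuous in $x$ with constant independent of $t$, and $u(t,x)-u(s,x)=\int_s^t g(r,x)\,dr$ for all $x\in\mathbb R^d$ and finite $s,t$ with $T\le s<t$. One writes $u_t=g$. $\mathcal C^{2+\alpha}_0(T)$ is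 the subset of $\mathcal C^{2+\alpha}(T)$ of functions vanishing for large $|x|+|t|$. Basic estimate (E): $N$ is a constant depending only on $d,\delta,\alpha$ such that, for every $T\in[-\infty,\infty)$, every operator $L_0u=a^{ij}(t)u_{x^ix^j}$ with $(a^{ij}(t))$ symmetric, measurable in $t\in(T,\infty)$ and satisfying $K(\delta^{ij})\ge(a^{ij}(t))\ge\delta(\delta^{ij})$ for some $K\in(0,\infty)$, every $u\in\mathcal C^{2+\alpha}_0(T)$ and every finite $t\ge T$, $$[u(t,\cdot)]_{2+\alpha}\le N\sup_{r>t}[(u_t+L_0u)(r,\cdot)]_\alpha .$$ (Such a constant, independent of $K$, exists; this is taken as given in the statement.) The functions $b_0,c_0$ are defined for the times $t$ under consideration, and "locally bounded" means bounded on bounded intervals. *)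

theory Defs
  imports "HOL-Analysis.Analysis"
begin

text \<open>
  Space is \<open>real ^ 'd\<close>, so that \<open>d = CARD('d) \<ge> 1\<close>; space-time is \<open>real \<times> (real ^ 'd)\<close>, with time
  as first component. The initial time \<open>T\<close> is an \<open>ereal\<close> different from \<open>\<infinity>\<close>. Functions on
  \<open>[T, \<infinity>) \<times> real ^ 'd\<close> are total functions, and only their values on that set are ever used.
  Norms and seminorms take values in \<open>ennreal\<close>, because they may be infinite.
\<close>

definition dir_deriv :: "('a::real_normed_vector \<Rightarrow> real) \<Rightarrow> 'a \<Rightarrow> 'a \<Rightarrow> real" where
  "dir_deriv f v x = frechet_derivative f (at x) v"

definition pderivative :: "'d \<Rightarrow> (real ^ 'd \<Rightarrow> real) \<Rightarrow> real ^ 'd::finite \<Rightarrow> real" where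
  "pderivative i f = dir_deriv f (axis i 1)"

definition gradient :: "(real ^ 'd \<Rightarrow> real) \<Rightarrow> real ^ 'd \<Rightarrow> real ^ 'd::finite" where
  "gradient f x = (\<chi> i. pderivative i f x)"

text \<open>The norm on matrices \<open>real ^ 'd ^ 'd\<close> is the Euclidean (Frobenius) norm.\<close>

definition hessian :: "(real ^ 'd \<Rightarrow> real) \<Rightarrow> real ^ 'd \<Rightarrow> real ^ 'd ^ 'd::finite" where
  "hessian f x = (\<chi> i j. pderivative j (pderivative i f) x)"

definition sup_norm :: "('a \<Rightarrow> 'b::real_normed_vector) \<Rightarrow> ennreal" where
  "sup_norm g = (SUP x. ennreal (norm (g x)))"

definition holder_seminorm ::
    "real \<Rightarrow> ('a::real_normed_vector \<Rightarrow> 'b::real_normed_vector) \<Rightarrow> ennreal" where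
  "holder_seminorm \<alpha> g =
     (SUP (x, y) \<in> {(x, y). x \<noteq> y}. ennreal (norm (g x - g y) / norm (x - y) powr \<alpha>))"

definition holder2_seminorm :: "real \<Rightarrow> (real ^ 'd::finite \<Rightarrow> real) \<Rightarrow> ennreal" where
  "holder2_seminorm \<alpha> u = holder_seminorm \<alpha> (hessian u)"

definition holder2_norm :: "real \<Rightarrow> (real ^ 'd::finite \<Rightarrow> real) \<Rightarrow> ennreal" where
  "holder2_norm \<alpha> u =
     sup_norm u + sup_norm (gradient u) + sup_norm (hessian u) + holder2_seminorm \<alpha> u"

text \<open>
  Differentiability has to be required explicitly, since \<open>frechet_derivative\<close> is total.
  Continuity of the second derivatives follows from the finiteness of the norm.
\<close>

definition holder2_space :: "real \<Rightarrow> (real ^ 'd::finite \<Rightarrow> real) set" where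
  "holder2_space \<alpha> =
     {u. (\<forall>x. u differentiable (at x)) \<and> (\<forall>i x. pderivative i u differentiable (at x)) \<and>
         holder2_norm \<alpha> u < \<infinity>}"

primrec times_diff :: "nat \<Rightarrow> ('a::euclidean_space \<Rightarrow> real) \<Rightarrow> bool" where
  "times_diff 0 f \<longleftrightarrow> continuous_on UNIV f"
| "times_diff (Suc k) f \<longleftrightarrow>
     (\<forall>x. f differentiable (at x)) \<and> (\<forall>b\<in>Basis. times_diff k (dir_deriv f b))"

definition test_functions :: "('a::euclidean_space \<Rightarrow> real) set" where
  "test_functions = {\<zeta>. (\<forall>k. times_diff k \<zeta>) \<and> compact (closure {p. \<zeta> p \<noteq> 0})}"

definition times_from :: "ereal \<Rightarrow> real set" where
  "times_from T = {t. T \<le> ereal t}"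

definition times_after :: "ereal \<Rightarrow> real set" where
  "times_after T = {t. T < ereal t}"

definition spacetime :: "ereal \<Rightarrow> (real \<times> (real ^ 'd::finite)) set" where
  "spacetime T = times_from T \<times> UNIV"

text \<open>
  \<open>is_time_derivative \<alpha> T u g\<close> says that \<open>g\<close> is a version of \<open>u\<^sub>t\<close>. The function \<open>g\<close> is only
  determined up to a null set of times, so this is a relation; statements about \<open>u\<^sub>t\<close> are made
  for all versions. Measurable means Lebesgue measurable.
\<close>

definition is_time_derivative ::
    "real \<Rightarrow> ereal \<Rightarrow> (real \<times> (real ^ 'd) \<Rightarrow> real) \<Rightarrow> (real \<times> (real ^ 'd::finite) \<Rightarrow> real) \<Rightarrow> bool" where
  "is_time_derivative \<alpha> T u g \<longleftrightarrow>
     g \<in> borel_measurable (lebesgue_on (spacetime T)) \<and>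
     (\<forall>\<zeta>\<in>test_functions.
        bounded ((\<lambda>p. \<zeta> p * g p) ` spacetime T) \<and>
        (SUP t\<in>times_from T. holder_seminorm \<alpha> (\<lambda>x. \<zeta> (t, x) * g (t, x))) < \<infinity>) \<and>
     (\<forall>x. \<forall>s\<in>times_from T. \<forall>t. s < t \<longrightarrow>
        set_integrable lebesgue {s..t} (\<lambda>r. g (r, x)) \<and>
        u (t, x) - u (s, x) = (LINT r:{s..t}|lebesgue. g (r, x)))"

definition parabolic_space :: "real \<Rightarrow> ereal \<Rightarrow> (real \<times> (real ^ 'd::finite) \<Rightarrow> real) set" where
  "parabolic_space \<alpha> T =
     {u. continuous_on (spacetime T) u \<and>
         (\<forall>t\<in>times_from T. (\<lambda>x. u (t, x)) \<in> holder2_space \<alpha>) \<and>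
         (SUP t\<in>times_from T. holder2_norm \<alpha> (\<lambda>x. u (t, x))) < \<infinity> \<and>
         (\<exists>g. is_time_derivative \<alpha> T u g)}"

definition parabolic_space0 :: "real \<Rightarrow> ereal \<Rightarrow> (real \<times> (real ^ 'd::finite) \<Rightarrow> real) set" where
  "parabolic_space0 \<alpha> T =
     {u \<in> parabolic_space \<alpha> T.
        \<exists>R. \<forall>t\<in>times_from T. \<forall>x. R \<le> norm x + \<bar>t\<bar> \<longrightarrow> u (t, x) = 0}"

text \<open>The operator \<open>f \<mapsto> A\<^sup>i\<^sup>j f\<^sub>x\<^sub>i\<^sub>x\<^sub>j\<close>.\<close>

definition second_order_op ::
    "real ^ 'd ^ 'd \<Rightarrow> (real ^ 'd \<Rightarrow> real) \<Rightarrow> real ^ 'd::finite \<Rightarrow> real" where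
  "second_order_op A f x = (\<Sum>i\<in>UNIV. \<Sum>j\<in>UNIV. A $ i $ j * pderivative j (pderivative i f) x)"

text \<open>The operator \<open>f \<mapsto> b\<^sup>i f\<^sub>x\<^sub>i\<close>.\<close>

definition first_order_op ::
    "real ^ 'd \<Rightarrow> (real ^ 'd \<Rightarrow> real) \<Rightarrow> real ^ 'd::finite \<Rightarrow> real" where
  "first_order_op b f x = (\<Sum>i\<in>UNIV. b $ i * pderivative i f x)"

definition admissible_coeffs ::
    "real \<Rightarrow> real \<Rightarrow> ereal \<Rightarrow> (real \<Rightarrow> real ^ 'd ^ 'd::finite) \<Rightarrow> bool" where
  "admissible_coeffs \<delta> K T a \<longleftrightarrow>
     a \<in> borel_measurable (lebesgue_on (times_after T)) \<and>
     (\<forall>t\<in>times_after T.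
        transpose (a t) = a t \<and>
        (\<forall>\<xi>. \<delta> * (\<xi> \<bullet> \<xi>) \<le> \<xi> \<bullet> (a t *v \<xi>) \<and> \<xi> \<bullet> (a t *v \<xi>) \<le> K * (\<xi> \<bullet> \<xi>)))"

text \<open>
  \<open>basic_estimate TYPE('d) \<delta> \<alpha> N\<close>: the real number \<open>N\<close> is an admissible constant in the basic estimate
  for the dimension \<open>CARD('d)\<close>. All other data, in particular \<open>T\<close> and \<open>K\<close>, are
  quantified inside, so that \<open>N\<close> cannot depend on them.
\<close>

definition basic_estimate :: "'d::finite itself \<Rightarrow> real \<Rightarrow> real \<Rightarrow> real \<Rightarrow> bool" where
  "basic_estimate _ \<delta> \<alpha> N \<longleftrightarrow>
     (\<forall>T K. \<forall>a :: real \<Rightarrow> real ^ 'd ^ 'd. \<forall>u g. \<forall>t :: real.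
        T \<noteq> \<infinity> \<longrightarrow> 0 < K \<longrightarrow> admissible_coeffs \<delta> K T a \<longrightarrow>
        u \<in> parabolic_space0 \<alpha> T \<longrightarrow> is_time_derivative \<alpha> T u g \<longrightarrow> t \<in> times_from T \<longrightarrow>
        holder2_seminorm \<alpha> (\<lambda>x. u (t, x))
          \<le> ennreal N * (SUP r\<in>{t<..}. holder_seminorm \<alpha>
               (\<lambda>x. g (r, x) + second_order_op (a r) (\<lambda>y. u (r, y)) x)))"

text \<open>Boundedness on bounded intervals of times in \<open>(T, \<infinity>)\<close>.\<close>

definition locally_bounded_after :: "ereal \<Rightarrow> (real \<Rightarrow> 'a::real_normed_vector) \<Rightarrow> bool" where
  "locally_bounded_after T f \<longleftrightarrow> (\<forall>p q. bounded (f ` (times_after T \<inter> {p..q})))"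

end

theory Submission
  imports Defs
begin

text \<open>
  The proof removes the lower order terms by a change of the unknown function. Fix the time \<open>t\<close> at
  which the estimate is wanted, let \<open>B\<close> and \<open>C\<close> be the integrals of \<open>b\<^sub>0\<close> and \<open>c\<^sub>0\<close> from \<open>t\<close>, and put
  \<open>v (s, x) = \<eta> s * exp (- C s) * u (s, x + B s)\<close> for \<open>s \<ge> t\<close>. Since the coefficients of \<open>L\<^sub>0\<close> do not
  depend on \<open>x\<close>, the translation commutes with \<open>L\<^sub>0\<close>, and
  \<open>v\<^sub>t + L\<^sub>0 v = \<eta> * exp (- C) * (u\<^sub>t + L\<^sub>0 u + b\<^sub>0 u\<^sub>x - c\<^sub>0 u) (s, x + B s) + \<eta>' * exp (- C) * u (s, x + B s)\<close>.
  Hoelder seminorms are invariant under translations, and \<open>exp (- C) \<le> 1\<close> for \<open>s \<ge> t\<close> because \<open>c\<^sub>0 \<ge> 0\<close>.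
  The cutoff \<open>\<eta>\<close>, which decreases linearly from \<open>1\<close> at \<open>t\<close> to \<open>0\<close> with slope \<open>- \<epsilon>\<close>, makes \<open>v\<close> vanish
  for large times, so that the basic estimate on \<open>[t, \<infinity>)\<close> applies to it; its cost is \<open>\<epsilon>\<close>
  times the supremum over \<open>s\<close> of the seminorm of \<open>u (s, \<cdot>)\<close>, and \<open>\<epsilon> \<rightarrow> 0\<close> gives part (i). Part (ii) is part (i) for
  functions that do not depend on time.

  The work lies in showing that \<open>v\<close> is an admissible function with the expected time derivative, although
  \<open>b\<^sub>0\<close> and \<open>c\<^sub>0\<close> are only measurable and \<open>u\<^sub>t\<close> exists only in the integrated sense, with an exceptional
  null set of times that may depend on \<open>x\<close>. This is the chain rule \<open>indefinite_integral_chain\<close> for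
  \<open>s \<mapsto> u (s, x + B s)\<close>. It avoids pointwise differentiation in time: an increment over a short interval
  is written exactly as the integral of a density close to the expected one, the spatial increment by
  the mean value theorem and the temporal one by the definition of \<open>u\<^sub>t\<close>, and
  \<open>indefinite_integralI_local\<close> sums up such local information. It needs that the spatial gradient
  of \<open>u\<close> is continuous in time and space (\<open>continuous_gradient\<close>) and that \<open>u\<^sub>t\<close> is locally bounded and locally
  Hoelder continuous in \<open>x\<close> (\<open>time_derivative_local_bounds\<close>). The latter is extracted from the condition on
  products with test functions by means of one explicit bump function. Joint
  measurability of the new time derivative rests on its continuity in \<open>x\<close>
  (\<open>caratheodory_measurable\<close>). The locale \<open>moving_frame\<close> collects the conclusions about \<open>v\<close>.
\<close>

section \<open>Test functions\<close>

lemma has_derivative_dir_deriv: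
  assumes "f differentiable (at x)"
  shows "(f has_derivative (\<lambda>v. dir_deriv f v x)) (at x)"
  using assms by (simp add: dir_deriv_def frechet_derivative_works flip: eta_contract_eq)

lemma dir_deriv_eqI:
  assumes "(f has_derivative f') (at x)"
  shows "dir_deriv f v x = f' v"
  using frechet_derivative_at[OF assms] by (simp add: dir_deriv_def)

lemma dir_deriv_mult:
  assumes "f differentiable (at x)" "g differentiable (at x)"
  shows "dir_deriv (\<lambda>x. f x * g x) v x = f x * dir_deriv g v x + dir_deriv f v x * g x"
  by (rule dir_deriv_eqI) (auto intro!: derivative_eq_intros has_derivative_dir_deriv assms)

lemma dir_deriv_add:
  assumes "f differentiable (at x)" "g differentiable (at x)"
  shows "dir_deriv (\<lambda>x. f x + g x) v x = dir_deriv f v x + dir_deriv g v x"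
  by (rule dir_deriv_eqI) (auto intro!: derivative_eq_intros has_derivative_dir_deriv assms)

lemma times_diff_Suc_imp: "times_diff (Suc k) f \<Longrightarrow> times_diff k f"
proof (induction k arbitrary: f)
  case 0
  then show ?case
    by (auto intro!: continuous_at_imp_continuous_on differentiable_imp_continuous_within)
next
  case (Suc k)
  then show ?case by auto
qed

lemma times_diff_add: "times_diff k f \<Longrightarrow> times_diff k g \<Longrightarrow> times_diff k (\<lambda>x. f x + g x)"
proof (induction k arbitrary: f g)
  case 0
  then show ?case by (auto intro: continuous_intros)
next
  case (Suc k)
  then have "dir_deriv (\<lambda>x. f x + g x) b = (\<lambda>x. dir_deriv f b x + dir_deriv g b x)" for b
    by (auto simp: dir_deriv_add)
  with Suc show ?case by auto
qed

lemma times_diff_mult: "times_diff k f \<Longrightarrow> times_diff k g \<Longrightarrow> times_diff k (\<lambda>x. f x * g x)"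
proof (induction k arbitrary: f g)
  case 0
  then show ?case by (auto intro: continuous_intros)
next
  case (Suc k)
  then have "dir_deriv (\<lambda>x. f x * g x) b = (\<lambda>x. f x * dir_deriv g b x + dir_deriv f b x * g x)" for b
    by (auto simp: dir_deriv_mult)
  moreover from Suc.prems have "times_diff k f" "times_diff k g"
    by (auto dest: times_diff_Suc_imp simp del: times_diff.simps)
  ultimately show ?case using Suc by (auto intro!: times_diff_add)
qed

lemma times_diff_const: "times_diff k (\<lambda>x. c)"
proof (induction k arbitrary: c)
  case (Suc k)
  have "dir_deriv (\<lambda>x. c) b = (\<lambda>x. 0)" for b :: 'a
    by (rule ext) (simp add: dir_deriv_def)
  then show ?case using Suc[of 0] by simp
qed simp

lemma times_diff_inner: "times_diff k (\<lambda>p. p \<bullet> v)"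
proof (cases k)
  case 0
  then show ?thesis by (auto intro: continuous_intros)
next
  case (Suc n)
  have d: "((\<lambda>p. p \<bullet> v) has_derivative (\<lambda>w. w \<bullet> v)) (at x)" for x
    by (auto intro!: derivative_eq_intros)
  then have "dir_deriv (\<lambda>p. p \<bullet> v) b = (\<lambda>x. b \<bullet> v)" for b
    by (intro ext dir_deriv_eqI)
  with d Suc show ?thesis by (auto intro: times_diff_const differentiableI)
qed

text \<open>
  Up to factors, differentiating \<open>exp (- 1 / x)\<close> produces only these functions, so that a statement about the
  whole family can be proved by induction on the order of differentiation.
\<close>

definition flat :: "nat \<Rightarrow> real \<Rightarrow> real" where
  "flat m x = (if x > 0 then exp (- (1 / x)) / x ^ m else 0)"

text \<open>
  From \<open>(1 + y / n) ^ n \<le> exp y\<close> with \<open>y = 1 / x\<close> and \<open>n = m + 2\<close>. The power \<open>x\<^sup>2\<close> is what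
  differentiability at \<open>0\<close> requires.
\<close>

lemma abs_flat_le: "\<bar>flat m x\<bar> \<le> real (m + 2) ^ (m + 2) * x\<^sup>2"
proof (cases "x > 0")
  case True
  define n where "n = m + 2"
  have "(1 / x / n) ^ n \<le> (1 + (1 / x) / n) ^ n"
    using True by (intro power_mono) (auto simp: n_def)
  also have "\<dots> \<le> exp (1 / x)"
    using True by (intro exp_ge_one_plus_x_over_n_power_n) (auto simp: n_def intro: order_trans[of _ 0])
  finally have "1 / (x ^ n * real n ^ n) \<le> exp (1 / x)"
    by (simp add: power_divide power_mult_distrib)
  moreover have "0 < x ^ n * real n ^ n"
    using True by (simp add: n_def)
  ultimately have "1 / exp (1 / x) \<le> x ^ n * real n ^ n"
    by (simp add: divide_le_eq mult.commute)
  then have "exp (- (1 / x)) / x ^ m \<le> (x ^ n * real n ^ n) / x ^ m"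
    using True by (intro divide_right_mono) (auto simp: exp_minus inverse_eq_divide)
  also have "\<dots> = real n ^ n * x\<^sup>2"
    using True by (simp add: n_def power_add power2_eq_square)
  finally show ?thesis
    using True by (simp add: flat_def n_def)
qed (auto simp: flat_def)

lemma flat_has_derivative:
  "(flat m has_real_derivative flat (m + 2) x - m * flat (m + 1) x) (at x)"
proof -
  consider "x > 0" | "x < 0" | "x = 0" by linarith
  then show ?thesis
  proof cases
    case 1
    have "((\<lambda>x. exp (- (1 / x)) / x ^ m) has_real_derivative flat (m + 2) x - m * flat (m + 1) x) (at x)"
    proof -
      have "real m * x ^ (m - Suc 0) * x = real m * x ^ m"
        by (cases m) auto
      then show ?thesis
        using 1 by (auto intro!: derivative_eq_intros simp: flat_def field_simps power2_eq_square)
    qed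
    then show ?thesis
      by (rule has_field_derivative_transform_within_open[where S="{0<..}"]) (use 1 in \<open>auto simp: flat_def\<close>)
  next
    case 2
    have "((\<lambda>x::real. 0::real) has_real_derivative flat (m + 2) x - m * flat (m + 1) x) (at x)"
      using 2 by (auto intro!: derivative_eq_intros simp: flat_def)
    then show ?thesis
      by (rule has_field_derivative_transform_within_open[where S="{..<0}"]) (use 2 in \<open>auto simp: flat_def\<close>)
  next
    case 3
    define C where "C = real (m + 2) ^ (m + 2)"
    have "((\<lambda>h. (flat m (0 + h) - flat m 0) / h) \<longlongrightarrow> 0) (at 0)"
    proof (rule Lim_null_comparison)
      show "\<forall>\<^sub>F h in at 0. norm ((flat m (0 + h) - flat m 0) / h) \<le> C * \<bar>h\<bar>"
      proof (rule always_eventually, rule allI)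
        fix h :: real
        show "norm ((flat m (0 + h) - flat m 0) / h) \<le> C * \<bar>h\<bar>"
          using abs_flat_le[of m h]
          by (cases "h = 0") (auto simp: flat_def[of m 0] C_def abs_divide divide_le_eq power2_eq_square algebra_simps)
      qed
      show "((\<lambda>h. C * \<bar>h\<bar>) \<longlongrightarrow> 0) (at 0)"
        by (auto intro!: tendsto_eq_intros)
    qed
    then show ?thesis
      using 3 by (simp add: DERIV_def flat_def[of _ 0])
  qed
qed

lemma times_diff_flat_ball:
  fixes R :: real
  shows "times_diff k (\<lambda>p::'a::euclidean_space. flat m (R\<^sup>2 - p \<bullet> p))"
proof (induction k arbitrary: m)
  case 0
  have "continuous_on UNIV (flat m)"
    using DERIV_isCont[OF flat_has_derivative] by (intro continuous_at_imp_continuous_on ballI)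
  then have "continuous_on UNIV (\<lambda>p::'a. flat m (R\<^sup>2 - p \<bullet> p))"
    by (rule continuous_on_compose2) (auto intro!: continuous_intros)
  then show ?case by simp
next
  case (Suc k)
  have d: "((\<lambda>p::'a. flat m (R\<^sup>2 - p \<bullet> p)) has_derivative
      (\<lambda>v. (flat (m + 2) (R\<^sup>2 - p \<bullet> p) + (- real m) * flat (m + 1) (R\<^sup>2 - p \<bullet> p)) * (p \<bullet> ((- 2) *\<^sub>R v)))) (at p)" for p
    by (rule has_derivative_eq_rhs[OF DERIV_compose_FDERIV[OF flat_has_derivative]])
       (auto intro!: derivative_eq_intros simp: algebra_simps inner_commute)
  then have "dir_deriv (\<lambda>p::'a. flat m (R\<^sup>2 - p \<bullet> p)) b =
      (\<lambda>p. (flat (m + 2) (R\<^sup>2 - p \<bullet> p) + (- real m) * flat (m + 1) (R\<^sup>2 - p \<bullet> p)) * (p \<bullet> ((- 2) *\<^sub>R b)))" for b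
    by (intro ext dir_deriv_eqI)
  moreover have "times_diff k (\<lambda>p::'a. (flat (m + 2) (R\<^sup>2 - p \<bullet> p) + (- real m) * flat (m + 1) (R\<^sup>2 - p \<bullet> p)) * (p \<bullet> ((- 2) *\<^sub>R b)))" for b
    by (intro times_diff_mult times_diff_add times_diff_const times_diff_inner Suc)
  ultimately show ?case using d by (auto simp: differentiable_def)
qed

lemma ex_test_function_positive_on_ball:
  fixes R :: real
  obtains \<zeta> :: "'a::euclidean_space \<Rightarrow> real"
  where "\<zeta> \<in> test_functions" "\<And>p. norm p < R \<Longrightarrow> 0 < \<zeta> p"
proof
  let ?z = "\<lambda>p::'a. flat 0 (R\<^sup>2 - p \<bullet> p)"
  have "{p. ?z p \<noteq> 0} \<subseteq> cball 0 \<bar>R\<bar>"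
    by (auto simp: flat_def dot_square_norm split: if_splits
          intro!: abs_le_square_iff[of "norm _" R, simplified, THEN iffD2])
  then show "?z \<in> test_functions"
    by (auto simp: test_functions_def times_diff_flat_ball compact_closure intro: bounded_subset[OF bounded_cball])
  show "0 < ?z p" if "norm p < R" for p
    using that power_strict_mono[OF that, of 2] by (auto simp: flat_def dot_square_norm)
qed

text \<open>
  The mean value inequality; the factor \<open>DIM('a)\<close> is the price of expanding the direction in the basis.
\<close>

lemma lipschitz_of_dir_deriv_bound:
  fixes f :: "'a::euclidean_space \<Rightarrow> real"
  assumes "\<And>x. f differentiable (at x)" "\<And>x b. b \<in> Basis \<Longrightarrow> \<bar>dir_deriv f b x\<bar> \<le> M"
  shows "\<bar>f x - f y\<bar> \<le> M * DIM('a) * norm (x - y)"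
proof -
  have der: "(f has_derivative (\<lambda>v. dir_deriv f v z)) (at z)" for z
    by (intro has_derivative_dir_deriv assms)
  have "onorm (\<lambda>v. dir_deriv f v z) \<le> M * DIM('a)" for z
  proof (rule onorm_bound)
    show "0 \<le> M * DIM('a)"
      using assms(2)[OF SOME_Basis] by (smt (verit) of_nat_0_le_iff mult_nonneg_nonneg)
    fix v
    have lin: "linear (\<lambda>v. dir_deriv f v z)" using der has_derivative_linear by blast
    have "dir_deriv f v z = dir_deriv f (\<Sum>b\<in>Basis. (v \<bullet> b) *\<^sub>R b) z" by (simp add: euclidean_representation)
    also have "\<dots> = (\<Sum>b\<in>Basis. (v \<bullet> b) * dir_deriv f b z)"
      by (subst linear_sum[OF lin]) (simp add: linear_scale[OF lin])
    also have "\<bar>\<dots>\<bar> \<le> (\<Sum>b\<in>(Basis::'a set). norm v * M)"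
      by (rule order_trans[OF sum_abs] sum_mono)+
         (auto simp: abs_mult intro!: mult_mono assms(2) Basis_le_norm)
    finally show "norm (dir_deriv f v z) \<le> M * DIM('a) * norm v" by (simp add: mult_ac)
  qed
  from differentiable_bound[OF convex_UNIV der this, of x y] show ?thesis
    by (simp add: norm_minus_commute)
qed

lemma test_function_lipschitz:
  fixes \<zeta> :: "'a::euclidean_space \<Rightarrow> real"
  assumes "\<zeta> \<in> test_functions"
  obtains M R where "0 \<le> M" "\<And>p. \<bar>\<zeta> p\<bar> \<le> M" "\<And>p q. \<bar>\<zeta> p - \<zeta> q\<bar> \<le> M * norm (p - q)"
    "\<And>p. R < norm p \<Longrightarrow> \<zeta> p = 0"
proof -
  define S where "S = closure {p. \<zeta> p \<noteq> 0}"
  have td: "times_diff k \<zeta>" for k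
    using assms by (auto simp: test_functions_def)
  have S: "compact S"
    using assms by (auto simp: test_functions_def S_def)
  have diff: "\<zeta> differentiable (at p)" for p using td[of 1] by simp
  have contd: "continuous_on UNIV (dir_deriv \<zeta> b)" if "b \<in> Basis" for b
    using td[of 1] that by simp
  have supp: "\<zeta> p = 0" if "p \<notin> S" for p
    using that closure_subset[of "{p. \<zeta> p \<noteq> 0}"] by (auto simp: S_def)
  have dsupp: "dir_deriv \<zeta> b p = 0" if "p \<notin> S" for b p
  proof (rule dir_deriv_eqI)
    show "(\<zeta> has_derivative (\<lambda>_. 0)) (at p)"
      by (rule has_derivative_transform_within_open[OF has_derivative_const, of "- S"])
         (use S that supp in \<open>auto simp: compact_imp_closed\<close>)
  qed
  have bdd: "\<exists>M. \<forall>p. \<bar>f p\<bar> \<le> M"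
    if f: "continuous_on UNIV f" "\<And>p. p \<notin> S \<Longrightarrow> f p = 0" for f :: "'a \<Rightarrow> real"
  proof -
    have "compact (f ` S)" using S f(1) by (metis compact_continuous_image continuous_on_subset subset_UNIV)
    then obtain M where "\<forall>p\<in>S. \<bar>f p\<bar> \<le> M"
      by (auto dest!: compact_imp_bounded simp: bounded_iff)
    then have "\<forall>p. \<bar>f p\<bar> \<le> max M 0" using f(2) by (metis abs_zero max.cobounded2 max.coboundedI1)
    then show ?thesis ..
  qed
  obtain M0 where M0: "\<And>p. \<bar>\<zeta> p\<bar> \<le> M0"
    using bdd[of \<zeta>] td[of 0] supp by auto
  obtain M1 where M1: "\<And>b p. b \<in> Basis \<Longrightarrow> \<bar>dir_deriv \<zeta> b p\<bar> \<le> M1 b"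
  proof -
    have "\<forall>b\<in>Basis. \<exists>M. \<forall>p. \<bar>dir_deriv \<zeta> b p\<bar> \<le> M"
      using bdd[OF contd] dsupp by auto
    then show ?thesis using that by metis
  qed
  define M2 where "M2 = (\<Sum>b\<in>Basis. M1 b)"
  have M1': "0 \<le> M1 b" if "b \<in> Basis" for b using M1[OF that] by (smt (verit))
  have M2: "\<bar>dir_deriv \<zeta> b p\<bar> \<le> M2" if "b \<in> Basis" for b p
    unfolding M2_def using M1[OF that, of p] member_le_sum[of b Basis M1] M1' that by fastforce
  obtain R where R: "\<And>p. p \<in> S \<Longrightarrow> norm p \<le> R"
    using compact_imp_bounded[OF S] unfolding bounded_iff by auto
  have lip: "\<bar>\<zeta> p - \<zeta> q\<bar> \<le> M2 * DIM('a) * norm (p - q)" for p q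
    by (rule lipschitz_of_dir_deriv_bound) (use diff M2 in auto)
  show ?thesis
  proof (rule that[of "max M0 (M2 * DIM('a))" R])
    show "0 \<le> max M0 (M2 * DIM('a))" using M0[of 0] by auto
    show "\<bar>\<zeta> p\<bar> \<le> max M0 (M2 * DIM('a))" for p using M0[of p] by auto
    show "\<bar>\<zeta> p - \<zeta> q\<bar> \<le> max M0 (M2 * DIM('a)) * norm (p - q)" for p q
      by (rule order_trans[OF lip mult_right_mono]) auto
    show "\<zeta> p = 0" if "R < norm p" for p using that R[of p] supp[of p] by fastforce
  qed
qed

section \<open>Hoelder seminorms\<close>

lemma sup_norm_le_iff:
  "0 \<le> C \<Longrightarrow> sup_norm f \<le> ennreal C \<longleftrightarrow> (\<forall>x. norm (f x) \<le> C)"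
  by (simp add: sup_norm_def SUP_le_iff ennreal_le_iff)

lemma holder_seminorm_le_iff:
  assumes "0 \<le> C"
  shows "holder_seminorm \<alpha> f \<le> ennreal C \<longleftrightarrow> (\<forall>x y. norm (f x - f y) \<le> C * norm (x - y) powr \<alpha>)"
proof -
  have "norm (f x - f y) \<le> C * norm (x - y) powr \<alpha> \<longleftrightarrow> norm (f x - f y) / norm (x - y) powr \<alpha> \<le> C"
    if "x \<noteq> y" for x y
    using that by (simp add: divide_le_eq)
  then show ?thesis
    using assms unfolding holder_seminorm_def SUP_le_iff
    by (auto simp: ennreal_le_iff) (metis diff_self mult_zero_right norm_zero order_refl powr_0)
qed

text \<open>
  For points at distance at most \<open>1\<close> the Lipschitz bound is the stronger one, for distant points the bound on
  the function suffices.
\<close>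

lemma lipschitz_bounded_imp_holder:
  fixes f :: "'a::real_normed_vector \<Rightarrow> real"
  assumes "0 < \<alpha>" "\<alpha> \<le> 1" "0 \<le> L"
    and "\<bar>f x - f y\<bar> \<le> L * norm (x - y)" "\<bar>f x\<bar> \<le> M" "\<bar>f y\<bar> \<le> M"
  shows "\<bar>f x - f y\<bar> \<le> (L + 2 * M) * norm (x - y) powr \<alpha>"
proof (cases "norm (x - y) \<le> 1")
  case True
  have "norm (x - y) \<le> norm (x - y) powr \<alpha>"
  proof (cases "x = y")
    case False
    then show ?thesis
      using powr_mono'[of \<alpha> 1 "norm (x - y)"] True assms(1,2) by simp
  qed simp
  then have "L * norm (x - y) \<le> L * norm (x - y) powr \<alpha>"
    using assms by (intro mult_left_mono)
  moreover have "0 \<le> 2 * M * norm (x - y) powr \<alpha>" using assms(5) by auto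
  ultimately show ?thesis using assms(4) by (simp add: algebra_simps)
next
  case False
  then have "1 \<le> norm (x - y) powr \<alpha>" using assms by (intro ge_one_powr_ge_zero) auto
  then have "(L + 2 * M) * 1 \<le> (L + 2 * M) * norm (x - y) powr \<alpha>"
    using assms by (intro mult_left_mono) auto
  moreover have "\<bar>f x - f y\<bar> \<le> L + 2 * M" using assms(3,5,6) by linarith
  ultimately show ?thesis by simp
qed

text \<open>
  The factor \<open>f\<close> need only be controlled on the ball that contains the support of \<open>z\<close>: in
  \<open>z x * f x - z y * f y = (z x - z y) * f x + z y * (f x - f y)\<close> one may choose \<open>x\<close> in the ball, and then
  the last term is zero unless \<open>y\<close> is in the ball, too.
\<close>

lemma product_holder_on_support:
  fixes z f :: "'a::real_normed_vector \<Rightarrow> real"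
  assumes \<alpha>: "0 < \<alpha>" "\<alpha> \<le> 1"
    and z: "\<And>x. \<bar>z x\<bar> \<le> M" "\<And>x y. \<bar>z x - z y\<bar> \<le> M * norm (x - y)" "\<And>x. R < norm x \<Longrightarrow> z x = 0"
    and f: "\<And>x. norm x \<le> R \<Longrightarrow> \<bar>f x\<bar> \<le> K"
      "\<And>x y. norm x \<le> R \<Longrightarrow> norm y \<le> R \<Longrightarrow> \<bar>f x - f y\<bar> \<le> K * norm (x - y) powr \<alpha>"
    and K: "0 \<le> K"
  shows "\<bar>z x * f x - z y * f y\<bar> \<le> 4 * M * K * norm (x - y) powr \<alpha>"
proof -
  have M: "0 \<le> M" using z(1)[of undefined] by linarith
  have zh: "\<bar>z x - z y\<bar> \<le> 3 * M * norm (x - y) powr \<alpha>" for x y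
    using lipschitz_bounded_imp_holder[OF \<alpha> M, of z x y M] z(1)[of x] z(1)[of y] z(2)[of x y] by simp
  have *: "\<bar>z x * f x - z y * f y\<bar> \<le> 4 * M * K * norm (x - y) powr \<alpha>" if x: "norm x \<le> R" for x y
  proof -
    have "\<bar>z y * (f x - f y)\<bar> \<le> M * (K * norm (x - y) powr \<alpha>)"
    proof (cases "norm y \<le> R")
      case True
      then show ?thesis unfolding abs_mult using x K M by (intro mult_mono z f) auto
    qed (use z(3) M K in auto)
    moreover have "\<bar>(z x - z y) * f x\<bar> \<le> 3 * M * norm (x - y) powr \<alpha> * K"
      unfolding abs_mult using x K M by (intro mult_mono zh f) auto
    moreover have "z x * f x - z y * f y = (z x - z y) * f x + z y * (f x - f y)"
      by (simp add: algebra_simps)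
    ultimately show ?thesis by (simp add: algebra_simps)
  qed
  show ?thesis
  proof (cases "norm x \<le> R \<or> norm y \<le> R")
    case True
    then show ?thesis using *[of x y] *[of y x] by (auto simp: norm_minus_commute abs_minus_commute)
  qed (use z(3) M K in auto)
qed

lemma holder_seminorm_add:
  "holder_seminorm \<alpha> (\<lambda>x. f x + g x) \<le> holder_seminorm \<alpha> f + holder_seminorm \<alpha> g"
proof -
  have le: "ennreal (norm (h x - h y) / norm (x - y) powr \<alpha>) \<le> holder_seminorm \<alpha> h"
    if "x \<noteq> y" for h :: "'a \<Rightarrow> 'b" and x y
    unfolding holder_seminorm_def using that by (intro SUP_upper2[of "(x, y)"]) auto
  have "ennreal (norm (f x + g x - (f y + g y)) / norm (x - y) powr \<alpha>)
      \<le> holder_seminorm \<alpha> f + holder_seminorm \<alpha> g" if "x \<noteq> y" for x y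
  proof -
    have "norm (f x + g x - (f y + g y)) / norm (x - y) powr \<alpha> \<le>
        norm (f x - f y) / norm (x - y) powr \<alpha> + norm (g x - g y) / norm (x - y) powr \<alpha>"
      unfolding add_divide_distrib[symmetric] by (intro divide_right_mono norm_diff_triangle_ineq) auto
    then have "ennreal (norm (f x + g x - (f y + g y)) / norm (x - y) powr \<alpha>) \<le>
        ennreal (norm (f x - f y) / norm (x - y) powr \<alpha>) + ennreal (norm (g x - g y) / norm (x - y) powr \<alpha>)"
      by (auto simp: ennreal_plus[symmetric] simp del: ennreal_plus intro!: ennreal_leI)
    also have "\<dots> \<le> holder_seminorm \<alpha> f + holder_seminorm \<alpha> g"
      by (intro add_mono le that)
    finally show ?thesis .
  qed
  then show ?thesis
    unfolding holder_seminorm_def[of \<alpha> "\<lambda>x. f x + g x"] by (intro SUP_least) auto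
qed

section \<open>Regularity of functions in parabolic spaces\<close>

text \<open>
  Divide the bounds for \<open>z * g\<close> by a test function \<open>z\<close> that is positive, hence bounded below, on a ball
  containing the region in question.
\<close>

lemma time_derivative_local_bounds:
  fixes g :: "real \<times> (real ^ 'd::finite) \<Rightarrow> real"
  assumes \<alpha>: "0 < \<alpha>" "\<alpha> \<le> 1" and g: "is_time_derivative \<alpha> T u g"
  obtains M where "0 \<le> M"
    "\<And>s x. s \<in> times_from T \<Longrightarrow> \<bar>s\<bar> \<le> \<rho> \<Longrightarrow> norm x \<le> \<rho> \<Longrightarrow> \<bar>g (s, x)\<bar> \<le> M"
    "\<And>s x y. s \<in> times_from T \<Longrightarrow> \<bar>s\<bar> \<le> \<rho> \<Longrightarrow> norm x \<le> \<rho> \<Longrightarrow> norm y \<le> \<rho> \<Longrightarrow>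
       \<bar>g (s, x) - g (s, y)\<bar> \<le> M * norm (x - y) powr \<alpha>"
proof -
  define K where "K = cball (0 :: real \<times> (real ^ 'd)) (2 * \<bar>\<rho>\<bar>)"
  obtain z :: "real \<times> (real ^ 'd) \<Rightarrow> real" where z: "z \<in> test_functions" "\<And>p. norm p < 2 * \<bar>\<rho>\<bar> + 1 \<Longrightarrow> 0 < z p"
    using ex_test_function_positive_on_ball by metis
  obtain L where L: "0 \<le> L" "\<And>p. \<bar>z p\<bar> \<le> L" "\<And>p q. \<bar>z p - z q\<bar> \<le> L * norm (p - q)"
    using test_function_lipschitz[OF z(1)] by metis
  have "times_diff 0 z" using z(1) unfolding test_functions_def by blast
  then have "continuous_on K z" using continuous_on_subset by auto
  then obtain p0 where p0: "p0 \<in> K" "\<And>p. p \<in> K \<Longrightarrow> z p0 \<le> z p"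
    using continuous_attains_inf[of K z] by (auto simp: K_def)
  define m where "m = z p0"
  have m: "0 < m" using p0(1) by (auto simp: m_def K_def intro!: z(2))
  have K: "(s, x) \<in> K" if "\<bar>s\<bar> \<le> \<rho>" "norm x \<le> \<rho>" for s x
    using that norm_Pair_le[of s x] by (auto simp: K_def)
  obtain C where C: "\<And>p. p \<in> spacetime T \<Longrightarrow> \<bar>z p * g p\<bar> \<le> C"
  proof -
    have "bounded ((\<lambda>p. z p * g p) ` spacetime T)"
      using g z(1) unfolding is_time_derivative_def by blast
    then obtain a where "\<forall>x\<in>(\<lambda>p. z p * g p) ` spacetime T. norm x \<le> a" unfolding bounded_iff by blast
    then show ?thesis using that[of a] by auto
  qed
  define S where "S = (SUP t\<in>times_from T. holder_seminorm \<alpha> (\<lambda>x. z (t, x) * g (t, x)))"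
  have "S < \<infinity>" using g z(1) by (auto simp: is_time_derivative_def S_def)
  then have S: "S = ennreal (enn2real S)" by simp
  define H where "H = enn2real S"
  have H0: "0 \<le> H" by (simp add: H_def)
  have "holder_seminorm \<alpha> (\<lambda>x. z (t, x) * g (t, x)) \<le> ennreal H" if "t \<in> times_from T" for t
    unfolding H_def S[symmetric] unfolding S_def by (rule SUP_upper[OF that])
  then have H: "\<bar>z (t, x) * g (t, x) - z (t, y) * g (t, y)\<bar> \<le> H * norm (x - y) powr \<alpha>"
    if "t \<in> times_from T" for t x y
    using that H0 by (auto simp: holder_seminorm_le_iff)
  have gb: "\<bar>g (s, x)\<bar> \<le> \<bar>C\<bar> / m" if "s \<in> times_from T" "\<bar>s\<bar> \<le> \<rho>" "norm x \<le> \<rho>" for s x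
  proof -
    have "m * \<bar>g (s, x)\<bar> \<le> z (s, x) * \<bar>g (s, x)\<bar>"
      using p0(2)[OF K[OF that(2,3)]] by (intro mult_right_mono) (auto simp: m_def)
    also have "\<dots> \<le> \<bar>z (s, x) * g (s, x)\<bar>" by (auto simp: abs_mult intro: mult_right_mono)
    also have "\<dots> \<le> C" using that by (intro C) (auto simp: spacetime_def)
    finally show ?thesis using m by (simp add: field_simps)
  qed
  have gh: "\<bar>g (s, x) - g (s, y)\<bar> \<le> ((H + 3 * L * (\<bar>C\<bar> / m)) / m) * norm (x - y) powr \<alpha>"
    if s: "s \<in> times_from T" "\<bar>s\<bar> \<le> \<rho>" and xy: "norm x \<le> \<rho>" "norm y \<le> \<rho>" for s x y
  proof -
    have "\<bar>z (s, x) - z (s, y)\<bar> \<le> L * norm (x - y)"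
      using L(3)[of "(s, x)" "(s, y)"] by (simp add: norm_Pair)
    then have zh: "\<bar>z (s, x) - z (s, y)\<bar> \<le> 3 * L * norm (x - y) powr \<alpha>"
      using lipschitz_bounded_imp_holder[OF \<alpha> L(1), of "\<lambda>x. z (s, x)" x y L] L(2) by simp
    \<comment> \<open>The product rule for differences, solved for the difference of \<open>g\<close>.\<close>
    have "m * \<bar>g (s, x) - g (s, y)\<bar> \<le> z (s, x) * \<bar>g (s, x) - g (s, y)\<bar>"
      using p0(2)[OF K[OF s(2) xy(1)]] by (intro mult_right_mono) (auto simp: m_def)
    also have "\<dots> \<le> \<bar>z (s, x) * (g (s, x) - g (s, y))\<bar>" by (auto simp: abs_mult intro: mult_right_mono)
    also have "z (s, x) * (g (s, x) - g (s, y)) =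
        (z (s, x) * g (s, x) - z (s, y) * g (s, y)) - (z (s, x) - z (s, y)) * g (s, y)"
      by (simp add: algebra_simps)
    also have "\<bar>\<dots>\<bar> \<le> H * norm (x - y) powr \<alpha> + (3 * L * norm (x - y) powr \<alpha>) * (\<bar>C\<bar> / m)"
    proof -
      have "\<bar>(z (s, x) - z (s, y)) * g (s, y)\<bar> \<le> (3 * L * norm (x - y) powr \<alpha>) * (\<bar>C\<bar> / m)"
        unfolding abs_mult using L(1) s xy by (intro mult_mono zh gb) auto
      then show ?thesis using H[OF s(1), of x y] by linarith
    qed
    also have "\<dots> = (H + 3 * L * (\<bar>C\<bar> / m)) * norm (x - y) powr \<alpha>" by (simp add: algebra_simps)
    finally show ?thesis using m by (simp add: field_simps)
  qed
  define M where "M = \<bar>C\<bar> / m + (H + 3 * L * (\<bar>C\<bar> / m)) / m"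
  have pos: "0 \<le> \<bar>C\<bar> / m" "0 \<le> (H + 3 * L * (\<bar>C\<bar> / m)) / m"
    using m L(1) H0 by auto
  show ?thesis
  proof (rule that[of M])
    show "0 \<le> M" using pos by (simp add: M_def)
    show "\<bar>g (s, x)\<bar> \<le> M" if "s \<in> times_from T" "\<bar>s\<bar> \<le> \<rho>" "norm x \<le> \<rho>" for s x
      using gb[OF that] pos by (simp add: M_def)
    show "\<bar>g (s, x) - g (s, y)\<bar> \<le> M * norm (x - y) powr \<alpha>"
      if "s \<in> times_from T" "\<bar>s\<bar> \<le> \<rho>" "norm x \<le> \<rho>" "norm y \<le> \<rho>" for s x y
      by (rule order_trans[OF gh[OF that] mult_right_mono]) (use pos in \<open>auto simp: M_def\<close>)
  qed
qed

lemma has_derivative_gradient: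
  fixes f :: "real ^ 'd::finite \<Rightarrow> real"
  assumes "f differentiable (at x)"
  shows "(f has_derivative (\<lambda>v. gradient f x \<bullet> v)) (at x)"
proof -
  have der: "(f has_derivative (\<lambda>v. dir_deriv f v x)) (at x)"
    by (rule has_derivative_dir_deriv[OF assms])
  then have lin: "linear (\<lambda>v. dir_deriv f v x)" using has_derivative_linear by blast
  have "dir_deriv f v x = gradient f x \<bullet> v" for v
  proof -
    have "dir_deriv f v x = dir_deriv f (\<Sum>i\<in>UNIV. (v $ i) *\<^sub>R axis i 1) x"
      using basis_expansion[of v] by (simp add: scalar_mult_eq_scaleR)
    also have "\<dots> = (\<Sum>i\<in>UNIV. v $ i * pderivative i f x)"
      by (subst linear_sum[OF lin]) (simp add: linear_scale[OF lin] pderivative_def)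
    finally show ?thesis by (simp add: inner_vec_def gradient_def mult.commute)
  qed
  with der show ?thesis by simp
qed

lemma first_order_op_eq_inner: "first_order_op b f x = gradient f x \<bullet> b"
  by (simp add: first_order_op_def inner_vec_def gradient_def mult.commute)

lemma lipschitz_of_pderivative_bound:
  fixes f :: "real ^ 'd::finite \<Rightarrow> real"
  assumes "\<And>x. f differentiable (at x)" "\<And>i x. \<bar>pderivative i f x\<bar> \<le> M"
  shows "\<bar>f x - f y\<bar> \<le> M * CARD('d) * norm (x - y)"
proof -
  have "\<bar>dir_deriv f b x\<bar> \<le> M" if "b \<in> Basis" for b x
    using that assms(2) by (auto simp: Basis_vec_def pderivative_def)
  from lipschitz_of_dir_deriv_bound[OF assms(1) this, of x y] show ?thesis by simp
qed

lemma holder_of_pderivative_bound: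
  fixes f :: "real ^ 'd::finite \<Rightarrow> real"
  assumes "0 < \<alpha>" "\<alpha> \<le> 1" "\<And>x. f differentiable (at x)" "\<And>x. \<bar>f x\<bar> \<le> M" "\<And>i x. \<bar>pderivative i f x\<bar> \<le> M"
  shows "\<bar>f x - f y\<bar> \<le> (M * CARD('d) + 2 * M) * norm (x - y) powr \<alpha>"
proof -
  have "0 \<le> M" using assms(4)[of x] by linarith
  then show ?thesis
    using lipschitz_of_pderivative_bound[OF assms(3,5), of x y]
    by (intro lipschitz_bounded_imp_holder[OF assms(1,2)] assms(4)) auto
qed

lemma parabolic_space_bounds:
  fixes u :: "real \<times> (real ^ 'd::finite) \<Rightarrow> real"
  assumes u: "u \<in> parabolic_space \<alpha> T"
  obtains M where "0 \<le> M"
    "\<And>s x. s \<in> times_from T \<Longrightarrow> \<bar>u (s, x)\<bar> \<le> M"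
    "\<And>s i x. s \<in> times_from T \<Longrightarrow> \<bar>pderivative i (\<lambda>y. u (s, y)) x\<bar> \<le> M"
    "\<And>s i j x. s \<in> times_from T \<Longrightarrow> \<bar>pderivative j (pderivative i (\<lambda>y. u (s, y))) x\<bar> \<le> M"
proof -
  define S where "S = (SUP t\<in>times_from T. holder2_norm \<alpha> (\<lambda>x. u (t, x)))"
  have "S < \<infinity>" using u by (auto simp: parabolic_space_def S_def)
  then have S: "S = ennreal (enn2real S)" by simp
  define M where "M = enn2real S"
  have M0: "0 \<le> M" by (simp add: M_def)
  have *: "holder2_norm \<alpha> (\<lambda>x. u (t, x)) \<le> ennreal M" if "t \<in> times_from T" for t
    unfolding M_def S[symmetric] unfolding S_def by (rule SUP_upper[OF that])
  have sup: "sup_norm (\<lambda>x. u (t, x)) \<le> ennreal M" "sup_norm (gradient (\<lambda>x. u (t, x))) \<le> ennreal M"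
    "sup_norm (hessian (\<lambda>x. u (t, x))) \<le> ennreal M" if "t \<in> times_from T" for t
    by (rule order_trans[OF _ *[OF that]], simp add: holder2_norm_def add_increasing add_increasing2)+
  show ?thesis
  proof (rule that[OF M0])
    fix s assume s: "s \<in> times_from T"
    show "\<bar>u (s, x)\<bar> \<le> M" for x
      using sup(1)[OF s] M0 by (simp add: sup_norm_le_iff)
    have gr: "norm (gradient (\<lambda>y. u (s, y)) x) \<le> M" for x
      using sup(2)[OF s] M0 by (simp add: sup_norm_le_iff)
    show "\<bar>pderivative i (\<lambda>y. u (s, y)) x\<bar> \<le> M" for i x
      using component_le_norm_cart[of "gradient (\<lambda>y. u (s, y)) x" i] gr[of x] by (simp add: gradient_def)
    have he: "norm (hessian (\<lambda>y. u (s, y)) x) \<le> M" for x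
      using sup(3)[OF s] M0 by (simp add: sup_norm_le_iff)
    show "\<bar>pderivative j (pderivative i (\<lambda>y. u (s, y))) x\<bar> \<le> M" for i j x
      using component_le_norm_cart[of "hessian (\<lambda>y. u (s, y)) x $ i" j]
        Finite_Cartesian_Product.norm_nth_le[of "hessian (\<lambda>y. u (s, y)) x" i] he[of x] by (simp add: hessian_def)
  qed
qed

lemma parabolic_space_differentiable:
  assumes "u \<in> parabolic_space \<alpha> T" "s \<in> times_from T"
  shows "(\<lambda>y. u (s, y)) differentiable (at x)" "pderivative i (\<lambda>y. u (s, y)) differentiable (at x)"
  using assms by (auto simp: parabolic_space_def holder2_space_def)

text \<open>
  The gradient is Lipschitz continuous in space, uniformly in time, because the second derivatives are bounded.
  Hence difference quotients of \<open>u\<close> with step \<open>h\<close> approximate it within \<open>L * h\<close> at all times, and for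
  fixed \<open>h\<close> they are continuous in time because \<open>u\<close> is.
\<close>

lemma continuous_gradient:
  fixes u :: "real \<times> (real ^ 'd::finite) \<Rightarrow> real"
  assumes u: "u \<in> parabolic_space \<alpha> T"
  shows "continuous_on (spacetime T) (\<lambda>p. gradient (\<lambda>y. u (fst p, y)) (snd p))"
proof -
  obtain M where M: "0 \<le> M"
    "\<And>s i j x. s \<in> times_from T \<Longrightarrow> \<bar>pderivative j (pderivative i (\<lambda>y. u (s, y))) x\<bar> \<le> M"
    using parabolic_space_bounds[OF u] by metis
  have uc: "continuous_on (spacetime T) u" using u by (simp add: parabolic_space_def)
  define L where "L = M * CARD('d) + 1"
  have L: "0 < L" using M(1) by (auto simp: L_def intro: add_nonneg_pos)
  have lip: "\<bar>pderivative i (\<lambda>y. u (s, y)) x - pderivative i (\<lambda>y. u (s, y)) y\<bar> \<le> L * norm (x - y)"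
    if "s \<in> times_from T" for s i x y
    using lipschitz_of_pderivative_bound[OF parabolic_space_differentiable(2)[OF u that] M(2)[OF that], of i x y]
    by (rule order_trans) (auto simp: L_def intro!: mult_right_mono)
  have quot: "\<bar>pderivative i (\<lambda>y. u (s, y)) x - (u (s, x + h *\<^sub>R axis i 1) - u (s, x)) / h\<bar> \<le> L * h"
    if s: "s \<in> times_from T" and h: "0 < h" for s i x h
  proof -
    have d: "((\<lambda>l. u (s, x + l *\<^sub>R axis i 1)) has_derivative
        (\<lambda>k. gradient (\<lambda>y. u (s, y)) (x + l *\<^sub>R axis i 1) \<bullet> (k *\<^sub>R axis i 1))) (at l within {0..h})" for l
      by (rule has_derivative_compose[OF _ has_derivative_gradient[OF parabolic_space_differentiable(1)[OF u s]]])
         (auto intro!: derivative_eq_intros)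
    obtain l where l: "l \<in> {0<..<h}"
      "u (s, x + h *\<^sub>R axis i 1) - u (s, x + 0 *\<^sub>R axis i 1) =
         gradient (\<lambda>y. u (s, y)) (x + l *\<^sub>R axis i 1) \<bullet> ((h - 0) *\<^sub>R axis i 1)"
      using mvt_simple[OF h d] by auto
    then have "(u (s, x + h *\<^sub>R axis i 1) - u (s, x)) / h = pderivative i (\<lambda>y. u (s, y)) (x + l *\<^sub>R axis i 1)"
      using h by (simp add: inner_axis gradient_def)
    then show ?thesis
      using lip[OF s, of i x "x + l *\<^sub>R axis i 1"] l(1) L
      by (auto simp: norm_axis_1 intro: order_trans mult_left_mono)
  qed
  have "continuous_on (spacetime T) (\<lambda>p. pderivative i (\<lambda>y. u (fst p, y)) (snd p))" for i
    unfolding continuous_on_iff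
  proof (intro ballI allI impI)
    fix p :: "real \<times> (real ^ 'd)" and e :: real
    assume p: "p \<in> spacetime T" and e: "0 < e"
    obtain \<tau> x where px: "p = (\<tau>, x)" and \<tau>: "\<tau> \<in> times_from T" using p by (auto simp: spacetime_def)
    \<comment> \<open>The step makes each of the two approximation errors \<open>e / 8\<close>.\<close>
    define h where "h = e / (8 * L)"
    have h: "0 < h" "L * h = e / 8" using e L by (auto simp: h_def)
    have "\<exists>d>0. \<forall>s\<in>times_from T. \<bar>s - \<tau>\<bar> < d \<longrightarrow> \<bar>u (s, y) - u (\<tau>, y)\<bar> < h * e / 8" for y
    proof -
      have "0 < h * e / 8" using h e by simp
      then obtain d where d: "0 < d" "\<And>q. q \<in> spacetime T \<Longrightarrow> dist q (\<tau>, y) < d \<Longrightarrow> dist (u q) (u (\<tau>, y)) < h * e / 8"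
        using uc[unfolded continuous_on_iff, rule_format, of "(\<tau>, y)" "h * e / 8"] \<tau> by (auto simp: spacetime_def)
      show ?thesis
        using d(2)[of "(_, y)"] by (intro exI[of _ d] conjI d(1)) (auto simp: spacetime_def dist_Pair_Pair dist_real_def)
    qed
    then obtain d where d: "\<And>y. 0 < d y" "\<And>y s. s \<in> times_from T \<Longrightarrow> \<bar>s - \<tau>\<bar> < d y \<Longrightarrow> \<bar>u (s, y) - u (\<tau>, y)\<bar> < h * e / 8"
      by metis
    define x' where "x' = x + h *\<^sub>R axis i 1"
    show "\<exists>d>0. \<forall>q\<in>spacetime T. dist q p < d \<longrightarrow>
        dist (pderivative i (\<lambda>y. u (fst q, y)) (snd q)) (pderivative i (\<lambda>y. u (fst p, y)) (snd p)) < e"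
    proof (intro exI[of _ "min h (min (d x) (d x'))"] conjI ballI impI)
      fix q assume q: "q \<in> spacetime T" "dist q p < min h (min (d x) (d x'))"
      obtain s y where qs: "q = (s, y)" and s: "s \<in> times_from T" using q by (auto simp: spacetime_def)
      have ds: "\<bar>s - \<tau>\<bar> < min h (min (d x) (d x'))" "norm (y - x) < min h (min (d x) (d x'))"
        using dist_fst_le[of q p] dist_snd_le[of q p] q(2) by (auto simp: qs px dist_norm)
      have 1: "\<bar>pderivative i (\<lambda>y. u (s, y)) y - pderivative i (\<lambda>y. u (s, y)) x\<bar> \<le> e / 8"
        using lip[OF s, of i y x] ds(2) mult_left_mono[of "norm (y - x)" h L] L h(2) by simp
      have 2: "\<bar>u (s, x) - u (\<tau>, x)\<bar> < h * e / 8" "\<bar>u (s, x') - u (\<tau>, x')\<bar> < h * e / 8"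
        using d(2)[OF s] ds by auto
      have "(u (s, x') - u (s, x)) / h - (u (\<tau>, x') - u (\<tau>, x)) / h =
          ((u (s, x') - u (\<tau>, x')) - (u (s, x) - u (\<tau>, x))) / h"
        by (simp add: diff_divide_distrib)
      also have "\<bar>\<dots>\<bar> \<le> (h * e / 8 + h * e / 8) / h"
        unfolding abs_divide abs_of_pos[OF h(1)] using 2 h(1) by (intro divide_right_mono) linarith+
      also have "\<dots> = e / 4" using h(1) by simp
      finally have 3: "\<bar>(u (s, x') - u (s, x)) / h - (u (\<tau>, x') - u (\<tau>, x)) / h\<bar> \<le> e / 4" .
      show "dist (pderivative i (\<lambda>y. u (fst q, y)) (snd q)) (pderivative i (\<lambda>y. u (fst p, y)) (snd p)) < e"
        using 1 3 quot[OF s h(1), of i x] quot[OF \<tau> h(1), of i x] e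
        unfolding x'_def h(2) qs px dist_real_def fst_conv snd_conv by linarith
    qed (use h d in auto)
  qed
  then show ?thesis
    unfolding gradient_def by (rule continuous_on_vec_lambda)
qed

section \<open>Measurability on space-time\<close>

text \<open>
  Approximate \<open>Y\<close> by simple functions. The substitution of a function with countably many values
  preserves measurability, and the continuity of \<open>h\<close> in its second argument allows the passage to the limit.
\<close>

lemma caratheodory_measurable:
  fixes h :: "'a \<Rightarrow> 'b::{metric_space, second_countable_topology} \<Rightarrow> 'c::metric_space"
  assumes meas: "\<And>y. (\<lambda>x. h x y) \<in> borel_measurable M"
    and cont: "\<And>x. x \<in> space M \<Longrightarrow> continuous_on UNIV (h x)"
    and Y: "Y \<in> borel_measurable M"
  shows "(\<lambda>x. h x (Y x)) \<in> borel_measurable M"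
proof -
  obtain F where F: "\<And>i. simple_function M (F i)"
    "\<And>x. x \<in> space M \<Longrightarrow> (\<lambda>i. F i x) \<longlonglongrightarrow> Y x"
    using borel_measurable_implies_sequence_metric[OF Y, of undefined] by metis
  show ?thesis
  proof (rule borel_measurable_LIMSEQ_metric)
    show "(\<lambda>x. h x (F i x)) \<in> borel_measurable M" for i
    proof (rule measurable_compose_countable'[where f="\<lambda>y x. h x y" and g="F i" and I="F i ` space M"])
      show "countable (F i ` space M)"
        using simple_functionD(1)[OF F(1)] by (rule countable_finite)
      show "F i \<in> M \<rightarrow>\<^sub>M count_space (F i ` space M)"
        by (rule measurable_count_space_extend[OF subset_UNIV _ measurable_simple_function[OF F(1)]]) blast
    qed (rule meas)
    show "(\<lambda>i. h x (F i x)) \<longlonglongrightarrow> h x (Y x)" if "x \<in> space M" for x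
      using cont[OF that] F(2)[OF that]
      by (rule continuous_on_tendsto_compose) auto
  qed
qed

text \<open>
  Lebesgue measurable functions of time must remain Lebesgue measurable as functions on space-time.
  As the null set need not be a Borel set, the product rule for null sets is applied to a Borel null set
  that contains it.
\<close>

lemma null_set_Times_UNIV:
  assumes "N \<in> null_sets lebesgue"
  shows "N \<times> (UNIV :: 'b::euclidean_space set) \<in> null_sets (lebesgue :: (real \<times> 'b) measure)"
proof -
  obtain N' where N': "N' \<in> null_sets lborel" "N \<subseteq> N'"
    using assms null_sets_completion_iff2[of N lborel] by blast
  have "N' \<times> (UNIV :: 'b set) \<in> null_sets (lborel \<Otimes>\<^sub>M lborel)"
    using N' by (intro lborel.times_in_null_sets1) auto
  then show ?thesis
    using N'(2) by (subst null_sets_completion_iff2, intro bexI[of _ "N' \<times> UNIV"]) (auto simp: lborel_prod)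
qed

lemma lebesgue_set_Times_UNIV:
  assumes "S \<in> sets (lebesgue :: real measure)"
  shows "S \<times> (UNIV :: 'b::euclidean_space set) \<in> sets lebesgue"
proof -
  obtain C N N' where CN: "S = C \<union> N" "N \<subseteq> N'" "N' \<in> null_sets lborel" "C \<in> sets lborel"
    using assms by (rule sets_completionE)
  have "N \<in> null_sets lebesgue"
    using CN null_sets_completion_iff2[of N lborel] by blast
  then have "N \<times> (UNIV :: 'b set) \<in> sets lebesgue"
    by (rule null_setsD2[OF null_set_Times_UNIV])
  moreover have "C \<times> (UNIV :: 'b set) \<in> sets borel"
    using CN(4) by (intro borel_Times) auto
  then have "C \<times> (UNIV :: 'b set) \<in> sets lebesgue"
    by (simp add: sets_completionI_sets)
  ultimately have "C \<times> (UNIV :: 'b set) \<union> N \<times> UNIV \<in> sets lebesgue"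
    by (intro sets.Un)
  then show ?thesis
    by (simp only: CN(1) Sigma_Un_distrib1)
qed

lemma measurable_time_function:
  fixes f :: "real \<Rightarrow> 'a::euclidean_space"
  assumes "f \<in> borel_measurable (lebesgue_on S)" "S \<in> sets lebesgue"
  shows "(\<lambda>p. f (fst p)) \<in> borel_measurable (lebesgue_on (S \<times> (UNIV :: 'b::euclidean_space set)))"
proof -
  have "(\<lambda>p::real \<times> 'b. if p \<in> S \<times> UNIV then f (fst p) else 0) \<in> borel_measurable lebesgue"
  proof (rule measurableI)
    fix X :: "'a set" assume "X \<in> sets borel"
    have "(\<lambda>x. if x \<in> S then f x else 0) \<in> borel_measurable lebesgue"
      using assms by (simp add: borel_measurable_if)
    from measurable_sets[OF this \<open>X \<in> sets borel\<close>]
    have "((\<lambda>x. if x \<in> S then f x else 0) -` X \<inter> space lebesgue) \<times> (UNIV :: 'b set) \<in> sets lebesgue"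
      by (rule lebesgue_set_Times_UNIV)
    also have "((\<lambda>x. if x \<in> S then f x else 0) -` X \<inter> space lebesgue) \<times> (UNIV :: 'b set) =
      (\<lambda>p::real \<times> 'b. if p \<in> S \<times> UNIV then f (fst p) else 0) -` X \<inter> space lebesgue"
      by auto
    finally show "(\<lambda>p::real \<times> 'b. if p \<in> S \<times> UNIV then f (fst p) else 0) -` X \<inter> space lebesgue \<in> sets lebesgue" .
  qed auto
  then show ?thesis
    by (rule iffD1[OF borel_measurable_if[OF lebesgue_set_Times_UNIV[OF assms(2)]]])
qed

lemma measurable_on_ray:
  fixes f :: "real \<Rightarrow> 'a::euclidean_space"
  assumes "\<And>q. q > t0 \<Longrightarrow> f \<in> borel_measurable (lebesgue_on {t0..q})"
  shows "f \<in> borel_measurable (lebesgue_on {t0..})"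
proof -
  have "(\<lambda>x. if x \<in> {t0..} then f x else 0) \<in> borel_measurable lebesgue"
  proof (rule borel_measurable_LIMSEQ_metric)
    show "(\<lambda>x. if x \<in> {t0..t0 + real (Suc n)} then f x else 0) \<in> borel_measurable lebesgue" for n
      using assms[of "t0 + real (Suc n)"] by (subst borel_measurable_if) auto
    show "(\<lambda>n. if x \<in> {t0..t0 + real (Suc n)} then f x else 0) \<longlonglongrightarrow> (if x \<in> {t0..} then f x else 0)" for x
    proof (rule tendsto_eventually)
      obtain n0 where "x - t0 \<le> real n0" using real_arch_simple by blast
      then show "\<forall>\<^sub>F n in sequentially. (if x \<in> {t0..t0 + real (Suc n)} then f x else 0) = (if x \<in> {t0..} then f x else 0)"
        by (intro eventually_sequentiallyI[of n0]) auto
    qed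
  qed
  then show ?thesis by (subst (asm) borel_measurable_if) auto
qed

section \<open>Indefinite integrals and the chain rule\<close>

text \<open>
  The absolutely continuous functions on \<open>[t0, \<infinity>)\<close> with a given density.
  Differential calculus for them is done on this relation, without almost everywhere derivatives.
\<close>

definition indefinite_integral :: "real \<Rightarrow> (real \<Rightarrow> 'a::euclidean_space) \<Rightarrow> (real \<Rightarrow> 'a) \<Rightarrow> bool" where
  "indefinite_integral t0 f F \<longleftrightarrow>
     (\<forall>s t. t0 \<le> s \<longrightarrow> s < t \<longrightarrow> f absolutely_integrable_on {s..t} \<and> F t - F s = integral {s..t} f)"

definition locally_bounded_from :: "real \<Rightarrow> (real \<Rightarrow> 'a::real_normed_vector) \<Rightarrow> bool" where
  "locally_bounded_from t0 f \<longleftrightarrow> (\<forall>q. bounded (f ` {t0..q}))"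

lemma indefinite_integral_measurable:
  assumes "indefinite_integral t0 f F"
  shows "f \<in> borel_measurable (lebesgue_on {t0..})"
  using assms by (intro measurable_on_ray) (auto simp: indefinite_integral_def absolutely_integrable_measurable)

lemma locally_bounded_fromE:
  assumes "locally_bounded_from t0 f"
  obtains M where "0 < M" "\<And>r. t0 \<le> r \<Longrightarrow> r \<le> q \<Longrightarrow> norm (f r) \<le> M"
proof -
  have "bounded (f ` {t0..q})" using assms by (auto simp: locally_bounded_from_def)
  then obtain M where "0 < M" "\<forall>x\<in>f ` {t0..q}. norm x \<le> M" unfolding bounded_pos by blast
  then show ?thesis using that by auto
qed

lemma locally_bounded_fromI:
  assumes "\<And>q. \<exists>M. \<forall>r. t0 \<le> r \<longrightarrow> r \<le> q \<longrightarrow> norm (f r) \<le> M"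
  shows "locally_bounded_from t0 f"
  unfolding locally_bounded_from_def bounded_iff
proof
  fix q
  obtain M where "\<forall>r. t0 \<le> r \<longrightarrow> r \<le> q \<longrightarrow> norm (f r) \<le> M" using assms by blast
  then show "\<exists>a. \<forall>x\<in>f ` {t0..q}. norm x \<le> a" by (intro exI[of _ M]) auto
qed

lemma locally_bounded_from_continuous:
  assumes "continuous_on {t0..} f"
  shows "locally_bounded_from t0 f"
  unfolding locally_bounded_from_def
  by (auto intro!: compact_imp_bounded compact_continuous_image continuous_on_subset[OF assms])

lemma locally_bounded_from_mult:
  fixes f g :: "real \<Rightarrow> real"
  assumes "locally_bounded_from t0 f" "locally_bounded_from t0 g"
  shows "locally_bounded_from t0 (\<lambda>r. f r * g r)"
proof (rule locally_bounded_fromI)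
  fix q
  obtain M where M: "0 < M" "\<And>r. t0 \<le> r \<Longrightarrow> r \<le> q \<Longrightarrow> norm (f r) \<le> M"
    using locally_bounded_fromE[OF assms(1)] by metis
  obtain N where N: "0 < N" "\<And>r. t0 \<le> r \<Longrightarrow> r \<le> q \<Longrightarrow> norm (g r) \<le> N"
    using locally_bounded_fromE[OF assms(2)] by metis
  have "norm (f r * g r) \<le> M * N" if "t0 \<le> r" "r \<le> q" for r
    unfolding norm_mult using M(1) by (intro mult_mono M(2) N(2) that) auto
  then show "\<exists>M. \<forall>r. t0 \<le> r \<longrightarrow> r \<le> q \<longrightarrow> norm (f r * g r) \<le> M" by blast
qed

lemma locally_bounded_from_add:
  assumes "locally_bounded_from t0 f" "locally_bounded_from t0 g"
  shows "locally_bounded_from t0 (\<lambda>r. f r + g r)"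
  unfolding locally_bounded_from_def
  using assms by (auto simp: locally_bounded_from_def intro: bounded_plus_comp)

lemma absolutely_integrable_locally_bounded:
  fixes f :: "real \<Rightarrow> 'a::euclidean_space"
  assumes "f \<in> borel_measurable (lebesgue_on {t0..})" "locally_bounded_from t0 f" "t0 \<le> s"
  shows "f absolutely_integrable_on {s..t}"
proof -
  obtain M where M: "\<And>r. t0 \<le> r \<Longrightarrow> r \<le> t \<Longrightarrow> norm (f r) \<le> M"
    using locally_bounded_fromE[OF assms(2)] by metis
  show ?thesis
  proof (rule measurable_bounded_by_integrable_imp_absolutely_integrable[where g = "\<lambda>_. M"])
    show "f \<in> borel_measurable (lebesgue_on {s..t})"
      using assms by (intro measurable_restrict_mono[OF assms(1)]) auto
  qed (use M assms in auto)
qed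

lemma integral_indefinite_integral:
  fixes f :: "real \<Rightarrow> 'a::euclidean_space"
  assumes "f \<in> borel_measurable (lebesgue_on {t0..})" "locally_bounded_from t0 f"
  shows "indefinite_integral t0 f (\<lambda>t. integral {t0..t} f)"
  unfolding indefinite_integral_def
proof (intro allI impI conjI)
  fix s t assume st: "t0 \<le> s" "s < t"
  show "f absolutely_integrable_on {s..t}"
    by (intro absolutely_integrable_locally_bounded[OF assms] st)
  have "f integrable_on {t0..t}"
    by (intro set_lebesgue_integral_eq_integral(1) absolutely_integrable_locally_bounded[OF assms]) auto
  then show "integral {t0..t} f - integral {t0..s} f = integral {s..t} f"
    using st Henstock_Kurzweil_Integration.integral_combine[of t0 s t f] by (simp add: algebra_simps)
qed

lemma indefinite_integral_lipschitz:
  assumes "indefinite_integral t0 f F" "locally_bounded_from t0 f"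
  obtains M where "0 < M"
    "\<And>s t. t0 \<le> s \<Longrightarrow> t0 \<le> t \<Longrightarrow> s \<le> q \<Longrightarrow> t \<le> q \<Longrightarrow> norm (F t - F s) \<le> M * \<bar>t - s\<bar>"
proof -
  obtain M where M: "0 < M" "\<And>r. t0 \<le> r \<Longrightarrow> r \<le> q \<Longrightarrow> norm (f r) \<le> M"
    using locally_bounded_fromE[OF assms(2)] by metis
  have *: "norm (F t - F s) \<le> M * \<bar>t - s\<bar>" if "t0 \<le> s" "s < t" "t \<le> q" for s t
  proof -
    have "(f has_integral (F t - F s)) {s..t}"
      using assms(1) that set_lebesgue_integral_eq_integral(1)
      unfolding indefinite_integral_def by (metis integrable_integral)
    then have "norm (F t - F s) \<le> M * measure lborel {s..t}"
      using M that by (intro has_integral_bound_real[of M "{}"]) auto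
    then show ?thesis using that by auto
  qed
  show ?thesis
  proof (rule that[OF M(1)])
    fix s t assume "t0 \<le> s" "t0 \<le> t" "s \<le> q" "t \<le> q"
    then show "norm (F t - F s) \<le> M * \<bar>t - s\<bar>"
      using *[of s t] *[of t s] by (cases s t rule: linorder_cases) (auto simp: norm_minus_commute abs_minus_commute)
  qed
qed

lemma indefinite_integral_continuous:
  assumes "indefinite_integral t0 f F" "locally_bounded_from t0 f"
  shows "continuous_on {t0..} F"
  unfolding continuous_on_iff
proof (intro ballI allI impI)
  fix x e :: real assume x: "x \<in> {t0..}" and e: "0 < e"
  obtain M where M: "0 < M"
    "\<And>s t. t0 \<le> s \<Longrightarrow> t0 \<le> t \<Longrightarrow> s \<le> x + 1 \<Longrightarrow> t \<le> x + 1 \<Longrightarrow> norm (F t - F s) \<le> M * \<bar>t - s\<bar>"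
    using indefinite_integral_lipschitz[OF assms, of "x + 1"] by metis
  show "\<exists>d>0. \<forall>x'\<in>{t0..}. dist x' x < d \<longrightarrow> dist (F x') (F x) < e"
  proof (intro exI[of _ "min 1 (e / M)"] conjI ballI impI)
    fix y assume y: "y \<in> {t0..}" "dist y x < min 1 (e / M)"
    then have "norm (F y - F x) \<le> M * \<bar>y - x\<bar>" using x by (intro M(2)) (auto simp: dist_real_def)
    also have "\<dots> < M * (e / M)" using y M(1) by (intro mult_strict_left_mono) (auto simp: dist_real_def)
    finally show "dist (F y) (F x) < e" using M(1) by (simp add: dist_norm)
  qed (use e M in auto)
qed

text \<open>
  If the increments of \<open>F\<close> over short intervals near \<open>\<tau>\<close> are integrals of densities within \<open>e\<close> of \<open>f\<close>, then
  \<open>F\<close> differs from the integral of \<open>f\<close> by a function \<open>H\<close> with \<open>\<bar>H t - H s\<bar> \<le> e * \<bar>t - s\<bar>\<close> near \<open>\<tau>\<close>. So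
  \<open>H\<close> has derivative zero everywhere and is constant. The approximating density \<open>h\<close> may depend on the interval, which
  is what makes the criterion useful for compositions.
\<close>

lemma indefinite_integralI_local:
  fixes F f :: "real \<Rightarrow> real"
  assumes meas: "f \<in> borel_measurable (lebesgue_on {t0..})" and bdd: "locally_bounded_from t0 f"
    and loc: "\<And>\<tau> e. t0 \<le> \<tau> \<Longrightarrow> 0 < e \<Longrightarrow> \<exists>d>0. \<forall>s t. t0 \<le> s \<longrightarrow> s < t \<longrightarrow> \<bar>s - \<tau>\<bar> < d \<longrightarrow> \<bar>t - \<tau>\<bar> < d \<longrightarrow>
       (\<exists>h. h absolutely_integrable_on {s..t} \<and> F t - F s = integral {s..t} h \<and> (\<forall>r\<in>{s..t}. \<bar>h r - f r\<bar> \<le> e))"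
  shows "indefinite_integral t0 f F"
proof -
  define G where "G = (\<lambda>t. integral {t0..t} f)"
  have G: "indefinite_integral t0 f G"
    unfolding G_def by (rule integral_indefinite_integral[OF meas bdd])
  define H where "H = (\<lambda>t. F t - G t)"
  have "(H has_derivative (\<lambda>_. 0)) (at \<tau> within {t0..})" if \<tau>: "\<tau> \<in> {t0..}" for \<tau>
    unfolding has_derivative_within_alt
  proof (intro conjI allI impI bounded_linear_zero)
    fix e :: real assume e: "0 < e"
    obtain d where d: "0 < d" and dh: "\<And>s t. t0 \<le> s \<Longrightarrow> s < t \<Longrightarrow> \<bar>s - \<tau>\<bar> < d \<Longrightarrow> \<bar>t - \<tau>\<bar> < d \<Longrightarrow>
       (\<exists>h. h absolutely_integrable_on {s..t} \<and> F t - F s = integral {s..t} h \<and> (\<forall>r\<in>{s..t}. \<bar>h r - f r\<bar> \<le> e))"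
      using loc[of \<tau> e] \<tau> e by auto
    have *: "\<bar>H t - H s\<bar> \<le> e * \<bar>t - s\<bar>" if st: "t0 \<le> s" "s < t" "\<bar>s - \<tau>\<bar> < d" "\<bar>t - \<tau>\<bar> < d" for s t
    proof -
      obtain h where h: "h absolutely_integrable_on {s..t}" "F t - F s = integral {s..t} h"
         "\<forall>r\<in>{s..t}. \<bar>h r - f r\<bar> \<le> e"
        using dh[OF st] by blast
      have f: "f absolutely_integrable_on {s..t}" "G t - G s = integral {s..t} f"
        using G st by (auto simp: indefinite_integral_def)
      have "((\<lambda>r. h r - f r) has_integral (integral {s..t} h - integral {s..t} f)) {s..t}"
        using h(1) f(1) set_lebesgue_integral_eq_integral(1)
        by (intro has_integral_diff integrable_integral) auto
      then have "norm (integral {s..t} h - integral {s..t} f) \<le> e * measure lborel {s..t}"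
        using h(3) e by (intro has_integral_bound_real[of e "{}"]) auto
      then show ?thesis using st h(2) f(2) by (simp add: H_def algebra_simps)
    qed
    show "\<exists>d>0. \<forall>y\<in>{t0..}. norm (y - \<tau>) < d \<longrightarrow> norm (H y - H \<tau> - 0) \<le> e * norm (y - \<tau>)"
    proof (intro exI[of _ d] conjI ballI impI d)
      fix y assume "y \<in> {t0..}" "norm (y - \<tau>) < d"
      then show "norm (H y - H \<tau> - 0) \<le> e * norm (y - \<tau>)"
        using *[of y \<tau>] *[of \<tau> y] \<tau> d by (cases y \<tau> rule: linorder_cases) (auto simp: abs_minus_commute)
    qed
  qed
  then obtain c where c: "\<And>t. t \<in> {t0..} \<Longrightarrow> H t = c"
    using has_derivative_zero_constant[of "{t0..}" H] by (metis convex_real_interval(1))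
  have "F t - F s = G t - G s" if "t0 \<le> s" "s < t" for s t
    using c[of s] c[of t] that by (simp add: H_def)
  then show ?thesis using G by (simp add: indefinite_integral_def)
qed

lemma mean_value_segment:
  fixes f :: "'a::euclidean_space \<Rightarrow> real"
  assumes "\<And>y. (f has_derivative (\<lambda>v. D y \<bullet> v)) (at y)"
  obtains z where "z \<in> closed_segment p q" "f q - f p = D z \<bullet> (q - p)"
proof -
  have "((\<lambda>l. f (p + l *\<^sub>R (q - p))) has_derivative (\<lambda>h. D (p + l *\<^sub>R (q - p)) \<bullet> (h *\<^sub>R (q - p)))) (at l within {0..1})" for l :: real
    by (rule has_derivative_compose[OF _ assms]) (auto intro!: derivative_eq_intros)
  then obtain l where l: "l \<in> {0<..<1::real}"
    "f (p + 1 *\<^sub>R (q - p)) - f (p + 0 *\<^sub>R (q - p)) = D (p + l *\<^sub>R (q - p)) \<bullet> ((1 - 0) *\<^sub>R (q - p))"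
    using mvt_simple[of 0 1 "\<lambda>l. f (p + l *\<^sub>R (q - p))" "\<lambda>l h. D (p + l *\<^sub>R (q - p)) \<bullet> (h *\<^sub>R (q - p))"]
    by auto
  show ?thesis
  proof (rule that)
    show "p + l *\<^sub>R (q - p) \<in> closed_segment p q"
      using l(1) by (auto simp: in_segment algebra_simps intro!: exI[of _ l])
  qed (use l(2) in simp)
qed

lemma continuous_on_of_local_equicontinuity:
  fixes g :: "real \<Rightarrow> 'a::euclidean_space \<Rightarrow> real"
  assumes equi: "\<And>\<rho> e. 0 < e \<Longrightarrow>
      \<exists>d>0. \<forall>s\<in>{t0..\<rho>}. \<forall>x\<in>cball 0 \<rho>. \<forall>x'\<in>cball 0 \<rho>. dist x x' < d \<longrightarrow> \<bar>g s x - g s x'\<bar> \<le> e"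
    and r: "t0 \<le> r"
  shows "continuous_on UNIV (g r)"
  unfolding continuous_on_iff
proof (intro ballI allI impI)
  fix x :: 'a and e :: real assume "0 < e"
  define \<rho> where "\<rho> = max r (norm x + 1)"
  obtain d where d: "0 < d" "\<And>s z z'. s\<in>{t0..\<rho>} \<Longrightarrow> z\<in>cball 0 \<rho> \<Longrightarrow> z'\<in>cball 0 \<rho> \<Longrightarrow> dist z z' < d \<Longrightarrow> \<bar>g s z - g s z'\<bar> \<le> e/2"
    using equi[of "e/2" \<rho>] \<open>0 < e\<close> by auto
  show "\<exists>d>0. \<forall>x'\<in>UNIV. dist x' x < d \<longrightarrow> dist (g r x') (g r x) < e"
  proof (intro exI[of _ "min d 1"] conjI ballI impI)
    fix x' assume x': "dist x' x < min d 1"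
    then have "norm x' \<le> norm x + 1" using norm_triangle_sub[of x' x] by (auto simp: dist_norm)
    then have "\<bar>g r x' - g r x\<bar> \<le> e/2"
      using x' r by (intro d) (auto simp: \<rho>_def)
    then show "dist (g r x') (g r x) < e" using \<open>0 < e\<close> by (simp add: dist_real_def)
  qed (use d in auto)
qed

text \<open>
  The increment of \<open>U r (Y r)\<close> over \<open>{s..t}\<close> is \<open>U t (Y t) - U t (Y s)\<close>, by the mean value
  theorem \<open>D t z \<bullet> (Y t - Y s)\<close>, plus \<open>U t (Y s) - U s (Y s)\<close>, in which the spatial argument is fixed. Both are
  exactly integrals, with the density \<open>g r (Y s) + D t z \<bullet> y r\<close>, which is close to the claimed one by the
  continuity of \<open>D\<close> and the equicontinuity of \<open>g\<close>, so that the local criterion applies.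
  Products and exponentials are special cases with \<open>g = 0\<close>.
\<close>

lemma indefinite_integral_chain:
  fixes U :: "real \<Rightarrow> 'a::euclidean_space \<Rightarrow> real" and Y :: "real \<Rightarrow> 'a"
  assumes U: "\<And>x. indefinite_integral t0 (\<lambda>r. g r x) (\<lambda>r. U r x)"
    and D: "\<And>s x. t0 \<le> s \<Longrightarrow> (U s has_derivative (\<lambda>v. D s x \<bullet> v)) (at x)"
    and contD: "continuous_on ({t0..} \<times> UNIV) (\<lambda>p. D (fst p) (snd p))"
    and bdd: "\<And>\<rho>. \<exists>M. \<forall>s\<in>{t0..\<rho>}. \<forall>x\<in>cball 0 \<rho>. \<bar>g s x\<bar> \<le> M"
    and equi: "\<And>\<rho> e. 0 < e \<Longrightarrow>
      \<exists>d>0. \<forall>s\<in>{t0..\<rho>}. \<forall>x\<in>cball 0 \<rho>. \<forall>x'\<in>cball 0 \<rho>. dist x x' < d \<longrightarrow> \<bar>g s x - g s x'\<bar> \<le> e"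
    and Y: "indefinite_integral t0 y Y" and y: "locally_bounded_from t0 y"
  shows "locally_bounded_from t0 (\<lambda>r. g r (Y r) + D r (Y r) \<bullet> y r)"
    and "indefinite_integral t0 (\<lambda>r. g r (Y r) + D r (Y r) \<bullet> y r) (\<lambda>r. U r (Y r))"
proof -
  let ?f = "\<lambda>r. g r (Y r) + D r (Y r) \<bullet> y r"
  have Yc: "continuous_on {t0..} Y" by (rule indefinite_integral_continuous[OF Y y])
  have DYc: "continuous_on {t0..} (\<lambda>r. D r (Y r))"
    by (rule continuous_on_compose2[OF contD, of "{t0..}" "\<lambda>r. (r, Y r)", simplified])
       (auto intro!: continuous_intros Yc)
  have gc: "continuous_on UNIV (g r)" if "t0 \<le> r" for r
    by (rule continuous_on_of_local_equicontinuity[OF equi that])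
  have meas: "?f \<in> borel_measurable (lebesgue_on {t0..})"
  proof (intro borel_measurable_add borel_measurable_inner)
    show "(\<lambda>r. g r (Y r)) \<in> borel_measurable (lebesgue_on {t0..})"
      by (rule caratheodory_measurable)
         (use gc in \<open>auto intro: indefinite_integral_measurable[OF U] continuous_imp_measurable_on_sets_lebesgue[OF Yc]\<close>)
    show "(\<lambda>r. D r (Y r)) \<in> borel_measurable (lebesgue_on {t0..})"
      by (rule continuous_imp_measurable_on_sets_lebesgue[OF DYc]) auto
    show "y \<in> borel_measurable (lebesgue_on {t0..})" by (rule indefinite_integral_measurable[OF Y])
  qed
  show bf: "locally_bounded_from t0 ?f"
  proof (rule locally_bounded_fromI)
    fix q
    obtain MY where MY: "\<And>r. t0 \<le> r \<Longrightarrow> r \<le> q \<Longrightarrow> norm (Y r) \<le> MY"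
      using locally_bounded_fromE[OF locally_bounded_from_continuous[OF Yc]] by metis
    obtain MD where MD: "\<And>r. t0 \<le> r \<Longrightarrow> r \<le> q \<Longrightarrow> norm (D r (Y r)) \<le> MD"
      using locally_bounded_fromE[OF locally_bounded_from_continuous[OF DYc]] by metis
    obtain My where My: "\<And>r. t0 \<le> r \<Longrightarrow> r \<le> q \<Longrightarrow> norm (y r) \<le> My"
      using locally_bounded_fromE[OF y] by metis
    obtain Mg where Mg: "\<forall>s\<in>{t0..max q MY}. \<forall>x\<in>cball 0 (max q MY). \<bar>g s x\<bar> \<le> Mg"
      using bdd by blast
    have "norm (?f r) \<le> Mg + MD * My" if r: "t0 \<le> r" "r \<le> q" for r
    proof -
      have "\<bar>g r (Y r)\<bar> \<le> Mg" using Mg MY[OF r] r by auto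
      moreover have "\<bar>D r (Y r) \<bullet> y r\<bar> \<le> MD * My"
        by (rule order_trans[OF Cauchy_Schwarz_ineq2]) (intro mult_mono MD My r order_trans[OF norm_ge_zero MD[OF r]] norm_ge_zero)
      ultimately show ?thesis by (auto intro: order_trans[OF abs_triangle_ineq])
    qed
    then show "\<exists>M. \<forall>r. t0 \<le> r \<longrightarrow> r \<le> q \<longrightarrow> norm (?f r) \<le> M" by blast
  qed
  show "indefinite_integral t0 ?f (\<lambda>r. U r (Y r))"
  proof (rule indefinite_integralI_local[OF meas bf])
    fix \<tau> e :: real assume \<tau>: "t0 \<le> \<tau>" and e: "0 < e"
    define q where "q = \<tau> + 1"
    obtain MY where MY: "\<And>r. t0 \<le> r \<Longrightarrow> r \<le> q \<Longrightarrow> norm (Y r) \<le> MY"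
      using locally_bounded_fromE[OF locally_bounded_from_continuous[OF Yc]] by metis
    obtain My where My: "0 < My" "\<And>r. t0 \<le> r \<Longrightarrow> r \<le> q \<Longrightarrow> norm (y r) \<le> My"
      using locally_bounded_fromE[OF y] by metis
    obtain L where L: "0 < L"
      "\<And>s t. t0 \<le> s \<Longrightarrow> t0 \<le> t \<Longrightarrow> s \<le> q \<Longrightarrow> t \<le> q \<Longrightarrow> norm (Y t - Y s) \<le> L * \<bar>t - s\<bar>"
      using indefinite_integral_lipschitz[OF Y y, of q] by metis
    define \<rho> where "\<rho> = max q MY"
    obtain d1 where d1: "0 < d1" "\<And>s z z'. s\<in>{t0..\<rho>} \<Longrightarrow> z\<in>cball 0 \<rho> \<Longrightarrow> z'\<in>cball 0 \<rho> \<Longrightarrow> dist z z' < d1 \<Longrightarrow> \<bar>g s z - g s z'\<bar> \<le> e/2"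
      using equi[of "e/2" \<rho>] e by auto
    \<comment> \<open>Two gradients within \<open>e'\<close> of a third contribute \<open>2 * e' * My = e / 2\<close>; the other half is left for \<open>g\<close>.\<close>
    define e' where "e' = e / (4 * My)"
    have e': "0 < e'" using e My by (simp add: e'_def)
    obtain d2 where d2: "0 < d2" "\<And>r z. t0 \<le> r \<Longrightarrow> dist (r, z) (\<tau>, Y \<tau>) < d2 \<Longrightarrow> dist (D r z) (D \<tau> (Y \<tau>)) < e'"
      using contD[unfolded continuous_on_iff, rule_format, of "(\<tau>, Y \<tau>)" e'] \<tau> e' by auto
    have near: "norm (D r z - D \<tau> (Y \<tau>)) < e'" if "t0 \<le> r" "\<bar>r - \<tau>\<bar> < d2 / 2" "norm (z - Y \<tau>) < d2 / 2" for r z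
    proof -
      have "dist (r, z) (\<tau>, Y \<tau>) \<le> \<bar>r - \<tau>\<bar> + norm (z - Y \<tau>)"
        using norm_Pair_le[of "r - \<tau>" "z - Y \<tau>"] by (simp add: dist_norm)
      with that d2(2)[of r z] show ?thesis by (simp add: dist_norm)
    qed
    \<comment> \<open>Within time \<open>d\<close> the curve \<open>Y\<close> moves by less than \<open>d2 / 2\<close>, within time \<open>2 * d\<close> by less than \<open>d1\<close>.\<close>
    define d where "d = min 1 (min (d2/2) (min (d2/2/L) (d1/2/L)))"
    have d: "0 < d" "d \<le> 1" "d \<le> d2/2" using L(1) d1(1) d2(1) by (auto simp: d_def)
    have "d \<le> d2/2/L" "d \<le> d1/2/L" by (auto simp: d_def)
    then have Ld: "L * d \<le> d2/2" "L * (2 * d) \<le> d1" using L(1) by (auto simp: field_simps)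
    show "\<exists>d>0. \<forall>s t. t0 \<le> s \<longrightarrow> s < t \<longrightarrow> \<bar>s - \<tau>\<bar> < d \<longrightarrow> \<bar>t - \<tau>\<bar> < d \<longrightarrow>
       (\<exists>h. h absolutely_integrable_on {s..t} \<and> U t (Y t) - U s (Y s) = integral {s..t} h \<and> (\<forall>r\<in>{s..t}. \<bar>h r - ?f r\<bar> \<le> e))"
    proof (intro exI[of _ d] conjI allI impI d(1))
      fix s t assume st: "t0 \<le> s" "s < t" "\<bar>s - \<tau>\<bar> < d" "\<bar>t - \<tau>\<bar> < d"
      have Ynear: "norm (Y r - Y \<tau>) < d2 / 2" if "r \<in> {s..t}" for r
      proof -
        have "norm (Y r - Y \<tau>) \<le> L * \<bar>r - \<tau>\<bar>" using that st d \<tau> by (intro L) (auto simp: q_def)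
        also have "\<dots> < L * d" using that st L by (intro mult_strict_left_mono) auto
        finally show ?thesis using Ld by simp
      qed
      obtain z where z: "z \<in> closed_segment (Y s) (Y t)" "U t (Y t) - U t (Y s) = D t z \<bullet> (Y t - Y s)"
        using mean_value_segment[of "U t" "D t" "Y s" "Y t"] D[of t] st by auto
      have "closed_segment (Y s) (Y t) \<subseteq> ball (Y \<tau>) (d2 / 2)"
        using Ynear[of s] Ynear[of t] st
        by (intro closed_segment_subset) (auto simp: dist_norm norm_minus_commute)
      then have Dz: "norm (D t z - D \<tau> (Y \<tau>)) < e'"
        using z(1) st d by (intro near) (auto simp: dist_norm norm_minus_commute)
      let ?h = "\<lambda>r. g r (Y s) + D t z \<bullet> y r"
      have y_int: "y absolutely_integrable_on {s..t}" "Y t - Y s = integral {s..t} y"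
        using Y st by (auto simp: indefinite_integral_def)
      have g_int: "(\<lambda>r. g r (Y s)) absolutely_integrable_on {s..t}" "U t (Y s) - U s (Y s) = integral {s..t} (\<lambda>r. g r (Y s))"
        using U st by (auto simp: indefinite_integral_def)
      have Dy_int: "(\<lambda>r. D t z \<bullet> y r) absolutely_integrable_on {s..t}"
        using absolutely_integrable_linear[OF y_int(1) bounded_linear_inner_right] by (simp add: o_def)
      have Dy_eq: "integral {s..t} (\<lambda>r. D t z \<bullet> y r) = D t z \<bullet> (Y t - Y s)"
        using integral_linear[OF set_lebesgue_integral_eq_integral(1)[OF y_int(1)] bounded_linear_inner_right[of "D t z"]] y_int(2)
        by (simp add: o_def)
      show "\<exists>h. h absolutely_integrable_on {s..t} \<and> U t (Y t) - U s (Y s) = integral {s..t} h \<and> (\<forall>r\<in>{s..t}. \<bar>h r - ?f r\<bar> \<le> e)"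
      proof (intro exI[of _ ?h] conjI ballI)
        show "?h absolutely_integrable_on {s..t}"
          by (intro set_integral_add g_int Dy_int)
        have "integral {s..t} ?h = integral {s..t} (\<lambda>r. g r (Y s)) + integral {s..t} (\<lambda>r. D t z \<bullet> y r)"
          by (intro Henstock_Kurzweil_Integration.integral_add set_lebesgue_integral_eq_integral(1) g_int Dy_int)
        then show "U t (Y t) - U s (Y s) = integral {s..t} ?h"
          using z(2) g_int(2) Dy_eq by simp
        fix r assume r: "r \<in> {s..t}"
        have rq: "t0 \<le> r" "r \<le> q" "s \<le> q" using r st d by (auto simp: q_def)
        have "norm (Y r - Y s) \<le> L * \<bar>r - s\<bar>" using rq st by (intro L) auto
        also have "\<dots> < L * (2 * d)" using r st L by (intro mult_strict_left_mono) auto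
        finally have "dist (Y s) (Y r) < d1" using Ld by (simp add: dist_norm norm_minus_commute)
        then have gg: "\<bar>g r (Y s) - g r (Y r)\<bar> \<le> e / 2"
          using MY[of r] MY[of s] rq st by (intro d1) (auto simp: \<rho>_def)
        have "norm (D r (Y r) - D \<tau> (Y \<tau>)) < e'"
        proof (rule near)
          have "\<bar>r - \<tau>\<bar> < d" using r st unfolding abs_less_iff atLeastAtMost_iff by linarith
          then show "\<bar>r - \<tau>\<bar> < d2 / 2" using d(3) by linarith
        qed (use Ynear[OF r] rq in auto)
        then have "norm (D t z - D r (Y r)) \<le> 2 * e'"
          using Dz norm_triangle_ineq4[of "D t z - D \<tau> (Y \<tau>)" "D r (Y r) - D \<tau> (Y \<tau>)"] by simp
        then have "\<bar>(D t z - D r (Y r)) \<bullet> y r\<bar> \<le> 2 * e' * My"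
          using My(2)[of r] rq e' by (intro order_trans[OF Cauchy_Schwarz_ineq2] mult_mono) auto
        also have "\<dots> = e / 2" using My(1) by (simp add: e'_def)
        finally show "\<bar>?h r - ?f r\<bar> \<le> e" using gg unfolding inner_diff_left by linarith
      qed
    qed
  qed
qed

lemma indefinite_integral_Pair:
  assumes F: "indefinite_integral t0 f F" and G: "indefinite_integral t0 g G"
  shows "indefinite_integral t0 (\<lambda>r. (f r, g r)) (\<lambda>r. (F r, G r))"
  unfolding indefinite_integral_def
proof (intro allI impI)
  fix s t assume st: "t0 \<le> s" "s < t"
  have f: "f absolutely_integrable_on {s..t}" "F t - F s = integral {s..t} f"
    and g: "g absolutely_integrable_on {s..t}" "G t - G s = integral {s..t} g"
    using F G st by (auto simp: indefinite_integral_def)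
  have b1: "bounded_linear (\<lambda>x::'a. (x, 0::'b))" and b2: "bounded_linear (\<lambda>x::'b. (0::'a, x))"
    by (auto intro!: bounded_linear_Pair bounded_linear_ident bounded_linear_zero)
  have i: "(\<lambda>r. (f r, 0::'b)) absolutely_integrable_on {s..t}" "(\<lambda>r. (0::'a, g r)) absolutely_integrable_on {s..t}"
    using absolutely_integrable_linear[OF f(1) b1] absolutely_integrable_linear[OF g(1) b2] by (auto simp: o_def)
  have e: "integral {s..t} (\<lambda>r. (f r, 0::'b)) = (F t - F s, 0)" "integral {s..t} (\<lambda>r. (0::'a, g r)) = (0, G t - G s)"
    using integral_linear[OF set_lebesgue_integral_eq_integral(1)[OF f(1)] b1]
      integral_linear[OF set_lebesgue_integral_eq_integral(1)[OF g(1)] b2] f g by (auto simp: o_def)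
  have "(\<lambda>r. (f r, g r)) absolutely_integrable_on {s..t}"
    using set_integral_add(1)[OF i] by simp
  moreover have "integral {s..t} (\<lambda>r. (f r, g r)) = (F t - F s, G t - G s)"
    using Henstock_Kurzweil_Integration.integral_add[OF i[THEN set_lebesgue_integral_eq_integral(1)]] e by simp
  ultimately show "(\<lambda>r. (f r, g r)) absolutely_integrable_on {s..t} \<and> (F t, G t) - (F s, G s) = integral {s..t} (\<lambda>r. (f r, g r))"
    by simp
qed

lemma locally_bounded_from_Pair:
  assumes "locally_bounded_from t0 f" "locally_bounded_from t0 g"
  shows "locally_bounded_from t0 (\<lambda>r. (f r, g r))"
proof (rule locally_bounded_fromI)
  fix q
  obtain M N where "\<And>r. t0 \<le> r \<Longrightarrow> r \<le> q \<Longrightarrow> norm (f r) \<le> M" "\<And>r. t0 \<le> r \<Longrightarrow> r \<le> q \<Longrightarrow> norm (g r) \<le> N"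
    using locally_bounded_fromE[OF assms(1)] locally_bounded_fromE[OF assms(2)] by metis
  then show "\<exists>M. \<forall>r. t0 \<le> r \<longrightarrow> r \<le> q \<longrightarrow> norm (f r, g r) \<le> M"
    by (intro exI[of _ "M + N"]) (auto intro!: order_trans[OF norm_Pair_le] add_mono)
qed

lemma indefinite_integral_const: "indefinite_integral t0 (\<lambda>_. 0) (\<lambda>_. c)"
  by (simp add: indefinite_integral_def)

lemma indefinite_integral_mult:
  fixes F G :: "real \<Rightarrow> real"
  assumes "indefinite_integral t0 f F" "locally_bounded_from t0 f"
    and "indefinite_integral t0 g G" "locally_bounded_from t0 g"
  shows "indefinite_integral t0 (\<lambda>r. F r * g r + f r * G r) (\<lambda>r. F r * G r)"
proof -
  have "indefinite_integral t0 (\<lambda>r. 0 + (snd (F r, G r), fst (F r, G r)) \<bullet> (f r, g r)) (\<lambda>r. fst (F r, G r) * snd (F r, G r))"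
    by (rule indefinite_integral_chain(2)[where U = "\<lambda>_ p. fst p * snd p" and D = "\<lambda>_ p. (snd p, fst p)"])
       (auto intro!: indefinite_integral_const indefinite_integral_Pair locally_bounded_from_Pair assms
          continuous_intros derivative_eq_intros exI[of _ 1] simp: inner_prod_def)
  then show ?thesis by (simp add: inner_prod_def algebra_simps)
qed

lemma indefinite_integral_exp:
  fixes F :: "real \<Rightarrow> real"
  assumes "indefinite_integral t0 f F" "locally_bounded_from t0 f"
  shows "indefinite_integral t0 (\<lambda>r. - (f r * exp (- F r))) (\<lambda>r. exp (- F r))"
proof -
  have "indefinite_integral t0 (\<lambda>r. 0 + (- exp (- F r)) \<bullet> f r) (\<lambda>r. exp (- F r))"
    by (rule indefinite_integral_chain(2)[where U = "\<lambda>_ x. exp (- x)" and D = "\<lambda>_ x. - exp (- x)"])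
       (auto intro!: indefinite_integral_const assms
          continuous_intros derivative_eq_intros exI[of _ 1])
  then show ?thesis by (simp add: algebra_simps)
qed

section \<open>Affine substitutions in space\<close>

lemma pderivative_affine:
  assumes "\<And>x. f differentiable (at x)"
  shows "pderivative i (\<lambda>y. c * f (y + z)) = (\<lambda>y. c * pderivative i f (y + z))"
    and "(\<lambda>y. c * f (y + z)) differentiable (at x)"
proof -
  have d: "((\<lambda>y. c * f (y + z)) has_derivative (\<lambda>v. c * dir_deriv f v (y + z))) (at y)" for y
  proof -
    have "((\<lambda>y. f (y + z)) has_derivative (\<lambda>v. dir_deriv f v (y + z))) (at y)"
      by (rule has_derivative_compose[OF _ has_derivative_dir_deriv[OF assms]]) (auto intro!: derivative_eq_intros)
    then show ?thesis by (rule has_derivative_mult_right)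
  qed
  then show "(\<lambda>y. c * f (y + z)) differentiable (at x)" by (auto simp: differentiable_def)
  show "pderivative i (\<lambda>y. c * f (y + z)) = (\<lambda>y. c * pderivative i f (y + z))"
    unfolding pderivative_def by (intro ext dir_deriv_eqI d)
qed

lemma gradient_affine:
  assumes "\<And>x. f differentiable (at x)"
  shows "gradient (\<lambda>y. c * f (y + z)) = (\<lambda>x. c *\<^sub>R gradient f (x + z))"
  by (rule ext) (simp add: gradient_def pderivative_affine[OF assms] vec_eq_iff)

lemma hessian_affine:
  assumes "\<And>x. f differentiable (at x)" "\<And>i x. pderivative i f differentiable (at x)"
  shows "hessian (\<lambda>y. c * f (y + z)) = (\<lambda>x. c *\<^sub>R hessian f (x + z))"
  by (rule ext) (simp add: hessian_def pderivative_affine[OF assms(1)] pderivative_affine[OF assms(2)] vec_eq_iff)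

lemma second_order_op_affine:
  assumes "\<And>x. f differentiable (at x)" "\<And>i x. pderivative i f differentiable (at x)"
  shows "second_order_op A (\<lambda>y. c * f (y + z)) x = c * second_order_op A f (x + z)"
  by (simp add: second_order_op_def pderivative_affine[OF assms(1)] pderivative_affine[OF assms(2)]
      sum_distrib_left mult_ac)

lemma sup_norm_affine: "sup_norm (\<lambda>x. c *\<^sub>R f (x + z)) \<le> ennreal \<bar>c\<bar> * sup_norm f"
  unfolding sup_norm_def
proof (rule SUP_least)
  fix x
  have "ennreal \<bar>c\<bar> * ennreal (norm (f (x + z))) \<le> ennreal \<bar>c\<bar> * (SUP x. ennreal (norm (f x)))"
    by (intro mult_left_mono SUP_upper) auto
  then show "ennreal (norm (c *\<^sub>R f (x + z))) \<le> ennreal \<bar>c\<bar> * (SUP x. ennreal (norm (f x)))"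
    by (simp add: ennreal_mult)
qed

lemma holder_seminorm_affine: "holder_seminorm \<alpha> (\<lambda>x. c *\<^sub>R f (x + z)) \<le> ennreal \<bar>c\<bar> * holder_seminorm \<alpha> f"
  unfolding holder_seminorm_def
proof (rule SUP_least, clarify)
  fix x y :: 'a assume "x \<noteq> y"
  then have "ennreal (norm (f (x + z) - f (y + z)) / norm (x - y) powr \<alpha>)
    \<le> (SUP (x, y)\<in>{(x, y). x \<noteq> y}. ennreal (norm (f x - f y) / norm (x - y) powr \<alpha>))"
    by (intro SUP_upper2[of "(x + z, y + z)"]) auto
  then have "ennreal \<bar>c\<bar> * ennreal (norm (f (x + z) - f (y + z)) / norm (x - y) powr \<alpha>)
    \<le> ennreal \<bar>c\<bar> * (SUP (x, y)\<in>{(x, y). x \<noteq> y}. ennreal (norm (f x - f y) / norm (x - y) powr \<alpha>))"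
    by (rule mult_left_mono) simp
  moreover have "ennreal (norm (c *\<^sub>R f (x + z) - c *\<^sub>R f (y + z)) / norm (x - y) powr \<alpha>) =
    ennreal \<bar>c\<bar> * ennreal (norm (f (x + z) - f (y + z)) / norm (x - y) powr \<alpha>)"
    by (simp add: ennreal_mult[symmetric] flip: scaleR_diff_right)
  ultimately show "ennreal (norm (c *\<^sub>R f (x + z) - c *\<^sub>R f (y + z)) / norm (x - y) powr \<alpha>)
    \<le> ennreal \<bar>c\<bar> * (SUP (x, y)\<in>{(x, y). x \<noteq> y}. ennreal (norm (f x - f y) / norm (x - y) powr \<alpha>))"
    by simp
qed

lemma holder2_norm_affine:
  fixes f :: "real ^ 'd::finite \<Rightarrow> real"
  assumes "\<And>x. f differentiable (at x)" "\<And>i x. pderivative i f differentiable (at x)"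
  shows "holder2_norm \<alpha> (\<lambda>y. c * f (y + z)) \<le> ennreal \<bar>c\<bar> * holder2_norm \<alpha> f"
  using sup_norm_affine[of c f z]
  unfolding holder2_norm_def holder2_seminorm_def gradient_affine[OF assms(1)] hessian_affine[OF assms] distrib_left
  by (intro add_mono sup_norm_affine holder_seminorm_affine) auto

lemma holder2_space_affine:
  assumes "f \<in> holder2_space \<alpha>"
  shows "(\<lambda>y. c * f (y + z)) \<in> holder2_space \<alpha>"
proof -
  have d: "\<And>x. f differentiable (at x)" "\<And>i x. pderivative i f differentiable (at x)"
    using assms by (auto simp: holder2_space_def)
  have "holder2_norm \<alpha> (\<lambda>y. c * f (y + z)) < \<infinity>"
    by (rule le_less_trans[OF holder2_norm_affine[OF d]])
       (use assms in \<open>auto simp: holder2_space_def ennreal_mult_less_top\<close>)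
  then show ?thesis
    unfolding holder2_space_def using pderivative_affine[OF d(1)] pderivative_affine(2)[OF d(2)]
    by simp
qed

section \<open>Characterisation of time derivatives by indefinite integrals\<close>

lemma indefinite_integral_shift:
  "indefinite_integral t0 f F \<Longrightarrow> indefinite_integral t0 f (\<lambda>r. x + F r)"
  by (simp add: indefinite_integral_def)

lemma times_from_ereal [simp]: "times_from (ereal t0) = {t0..}"
  by (auto simp: times_from_def)

lemma spacetime_ereal: "spacetime (ereal t0) = {t0..} \<times> UNIV"
  by (simp add: spacetime_def)

lemma is_time_derivative_indefinite_integral:
  assumes "is_time_derivative \<alpha> (ereal t0) u g"
  shows "indefinite_integral t0 (\<lambda>r. g (r, x)) (\<lambda>r. u (r, x))"
  unfolding indefinite_integral_def
proof (intro allI impI)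
  fix s t assume "t0 \<le> s" "s < t"
  then have "(\<lambda>r. g (r, x)) absolutely_integrable_on {s..t}"
    "u (t, x) - u (s, x) = (LINT r:{s..t}|lebesgue. g (r, x))"
    using assms unfolding is_time_derivative_def times_from_ereal by blast+
  then show "(\<lambda>r. g (r, x)) absolutely_integrable_on {s..t} \<and> u (t, x) - u (s, x) = integral {s..t} (\<lambda>r. g (r, x))"
    using set_lebesgue_integral_eq_integral(2) by metis
qed

text \<open>
  Local Hoelder continuity is passed on to products with test functions by \<open>product_holder_on_support\<close>, test
  functions being bounded and Lipschitz continuous.
\<close>

lemma is_time_derivativeI:
  fixes u w :: "real \<times> (real ^ 'd::finite) \<Rightarrow> real"
  assumes \<alpha>: "0 < \<alpha>" "\<alpha> \<le> 1"
    and meas: "w \<in> borel_measurable (lebesgue_on ({t0..} \<times> UNIV))"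
    and ii: "\<And>x. indefinite_integral t0 (\<lambda>r. w (r, x)) (\<lambda>r. u (r, x))"
    and loc: "\<And>\<rho>. \<exists>M\<ge>0. \<forall>s\<ge>t0. \<forall>x\<in>cball 0 \<rho>. \<bar>w (s, x)\<bar> \<le> M \<and>
        (\<forall>y\<in>cball 0 \<rho>. \<bar>w (s, x) - w (s, y)\<bar> \<le> M * norm (x - y) powr \<alpha>)"
  shows "is_time_derivative \<alpha> (ereal t0) u w"
  unfolding is_time_derivative_def times_from_ereal spacetime_ereal
proof (intro conjI ballI allI impI)
  fix z :: "real \<times> (real ^ 'd) \<Rightarrow> real" assume z: "z \<in> test_functions"
  obtain L R where L: "0 \<le> L" "\<And>p. \<bar>z p\<bar> \<le> L" "\<And>p q. \<bar>z p - z q\<bar> \<le> L * norm (p - q)"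
    "\<And>p. R < norm p \<Longrightarrow> z p = 0"
    using test_function_lipschitz[OF z] by metis
  obtain M where M: "0 \<le> M" "\<And>s x. t0 \<le> s \<Longrightarrow> norm x \<le> R \<Longrightarrow> \<bar>w (s, x)\<bar> \<le> M"
    "\<And>s x y. t0 \<le> s \<Longrightarrow> norm x \<le> R \<Longrightarrow> norm y \<le> R \<Longrightarrow> \<bar>w (s, x) - w (s, y)\<bar> \<le> M * norm (x - y) powr \<alpha>"
    using loc[of R] by auto
  have supp: "z (s, x) = 0" if "R < norm x" for s x
  proof (rule L(4))
    have "norm x \<le> norm (s, x)" by (simp add: norm_Pair)
    then show "R < norm (s, x)" using that by linarith
  qed
  have zl: "\<bar>z (s, x) - z (s, y)\<bar> \<le> L * norm (x - y)" for s x y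
    using L(3)[of "(s, x)" "(s, y)"] by (simp add: norm_Pair)
  have "\<bar>z (s, x) * w (s, x)\<bar> \<le> L * M" if "t0 \<le> s" for s x
  proof (cases "norm x \<le> R")
    case True
    then show ?thesis unfolding abs_mult using that M L by (intro mult_mono) auto
  qed (use supp L M in auto)
  then show "bounded ((\<lambda>p. z p * w p) ` ({t0..} \<times> UNIV))"
    unfolding bounded_iff by (intro exI[of _ "L * M"]) auto
  have "holder_seminorm \<alpha> (\<lambda>x. z (s, x) * w (s, x)) \<le> ennreal (4 * L * M)" if "t0 \<le> s" for s
  proof -
    have "\<bar>z (s, x) * w (s, x) - z (s, y) * w (s, y)\<bar> \<le> 4 * L * M * norm (x - y) powr \<alpha>" for x y
      by (rule product_holder_on_support[OF \<alpha>, of "\<lambda>x. z (s, x)" L R "\<lambda>x. w (s, x)" M])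
         (fact L(2) zl supp M(1) M(2)[OF that] M(3)[OF that])+
    then show ?thesis
      using L(1) M(1) by (subst holder_seminorm_le_iff) simp_all
  qed
  then have "(SUP t\<in>{t0..}. holder_seminorm \<alpha> (\<lambda>x. z (t, x) * w (t, x))) \<le> ennreal (4 * L * M)"
    by (intro SUP_least) auto
  then show "(SUP t\<in>{t0..}. holder_seminorm \<alpha> (\<lambda>x. z (t, x) * w (t, x))) < \<infinity>"
    by (rule le_less_trans) simp
next
  fix x s t assume st: "s \<in> {t0..}" "(s::real) < t"
  show "(\<lambda>r. w (r, x)) absolutely_integrable_on {s..t}"
    using ii[of x] st by (auto simp: indefinite_integral_def)
  then show "u (t, x) - u (s, x) = (LINT r:{s..t}|lebesgue. w (r, x))"
    using ii[of x] st set_lebesgue_integral_eq_integral(2)[of "{s..t}" "\<lambda>r. w (r, x)"]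
    by (simp add: indefinite_integral_def)
qed (rule meas)

section \<open>Moving frames\<close>

text \<open>
  The weighted translate \<open>v (s, x) = \<phi> s * u (s, x + B s)\<close> for an arbitrary translation \<open>B\<close> with locally
  bounded velocity \<open>b\<close> and an arbitrary weight \<open>\<phi>\<close> with density \<open>\<psi>\<close> that vanishes from time \<open>t1\<close> on.
\<close>

locale moving_frame =
  fixes \<alpha> t0 t1 :: real and u g :: "real \<times> (real ^ 'd::finite) \<Rightarrow> real"
    and b B :: "real \<Rightarrow> real ^ 'd" and \<psi> \<phi> :: "real \<Rightarrow> real"
  assumes \<alpha>: "0 < \<alpha>" "\<alpha> \<le> 1"
    and u: "u \<in> parabolic_space \<alpha> (ereal t0)"
    and g: "is_time_derivative \<alpha> (ereal t0) u g"
    and B: "indefinite_integral t0 b B" and b: "locally_bounded_from t0 b"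
    and \<phi>: "indefinite_integral t0 \<psi> \<phi>" and \<psi>: "locally_bounded_from t0 \<psi>"
    and t1: "\<And>r. t1 \<le> r \<Longrightarrow> \<phi> r = 0" "\<And>r. t1 \<le> r \<Longrightarrow> \<psi> r = 0"
begin

definition moved :: "real \<times> (real ^ 'd) \<Rightarrow> real" where
  "moved p = \<phi> (fst p) * u (fst p, snd p + B (fst p))"

definition moved_dt :: "real \<times> (real ^ 'd) \<Rightarrow> real" where
  "moved_dt p = \<phi> (fst p) * (g (fst p, snd p + B (fst p))
      + first_order_op (b (fst p)) (\<lambda>y. u (fst p, y)) (snd p + B (fst p)))
    + \<psi> (fst p) * u (fst p, snd p + B (fst p))"

lemma u_diff: "t0 \<le> s \<Longrightarrow> (\<lambda>y. u (s, y)) differentiable (at x)"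
  "t0 \<le> s \<Longrightarrow> pderivative i (\<lambda>y. u (s, y)) differentiable (at x)"
  using parabolic_space_differentiable[OF u] by auto

lemma u_cont: "continuous_on ({t0..} \<times> UNIV) u"
  using u by (simp add: parabolic_space_def spacetime_ereal)

lemma B_cont: "continuous_on {t0..} B" and \<phi>_cont: "continuous_on {t0..} \<phi>"
  by (rule indefinite_integral_continuous[OF B b] indefinite_integral_continuous[OF \<phi> \<psi>])+

lemma shift_cont: "continuous_on ({t0..} \<times> UNIV) (\<lambda>p::real \<times> (real ^ 'd). snd p + B (fst p))"
  by (intro continuous_intros continuous_on_compose2[OF B_cont]) auto

lemma u_shift_cont: "continuous_on ({t0..} \<times> UNIV) (\<lambda>p. u (fst p, snd p + B (fst p)))"
  by (rule continuous_on_compose2[OF u_cont]) (auto intro!: continuous_intros shift_cont)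

lemma moved_cont: "continuous_on ({t0..} \<times> UNIV) moved"
  unfolding moved_def
  by (intro continuous_on_mult u_shift_cont continuous_on_compose2[OF \<phi>_cont] continuous_intros) auto

lemma gradient_cont: "continuous_on ({t0..} \<times> UNIV) (\<lambda>p. gradient (\<lambda>y. u (fst p, y)) (snd p))"
  using continuous_gradient[OF u] by (simp add: spacetime_ereal)

lemma g_int: "indefinite_integral t0 (\<lambda>r. g (r, x)) (\<lambda>r. u (r, x))"
  by (rule is_time_derivative_indefinite_integral[OF g])

text \<open>
  As times are at least \<open>t0\<close>, an upper bound on \<open>s\<close> suffices.
\<close>

lemma g_bounds:
  obtains M where "0 \<le> M" "\<And>s x. t0 \<le> s \<Longrightarrow> s \<le> \<rho> \<Longrightarrow> norm x \<le> \<rho> \<Longrightarrow> \<bar>g (s, x)\<bar> \<le> M"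
    "\<And>s x y. t0 \<le> s \<Longrightarrow> s \<le> \<rho> \<Longrightarrow> norm x \<le> \<rho> \<Longrightarrow> norm y \<le> \<rho> \<Longrightarrow>
       \<bar>g (s, x) - g (s, y)\<bar> \<le> M * norm (x - y) powr \<alpha>"
proof -
  define \<rho>' where "\<rho>' = max \<bar>\<rho>\<bar> \<bar>t0\<bar>"
  obtain M where M: "0 \<le> M"
    "\<And>s x. s \<in> times_from (ereal t0) \<Longrightarrow> \<bar>s\<bar> \<le> \<rho>' \<Longrightarrow> norm x \<le> \<rho>' \<Longrightarrow> \<bar>g (s, x)\<bar> \<le> M"
    "\<And>s x y. s \<in> times_from (ereal t0) \<Longrightarrow> \<bar>s\<bar> \<le> \<rho>' \<Longrightarrow> norm x \<le> \<rho>' \<Longrightarrow> norm y \<le> \<rho>' \<Longrightarrow>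
       \<bar>g (s, x) - g (s, y)\<bar> \<le> M * norm (x - y) powr \<alpha>"
    using time_derivative_local_bounds[OF \<alpha> g] by metis
  show ?thesis
    by (rule that[OF M(1)]; rule M) (auto simp: \<rho>'_def)
qed

text \<open>
  The number \<open>d\<close> solves \<open>(M + 1) * d powr \<alpha> = e\<close>; adding \<open>1\<close> covers the case \<open>M = 0\<close>.
\<close>

lemma g_equicontinuous:
  assumes "0 < e"
  shows "\<exists>d>0. \<forall>s\<in>{t0..\<rho>}. \<forall>x\<in>cball 0 \<rho>. \<forall>x'\<in>cball 0 \<rho>. dist x x' < d \<longrightarrow> \<bar>g (s, x) - g (s, x')\<bar> \<le> e"
proof -
  obtain M where M: "0 \<le> M"
    "\<And>s x y. t0 \<le> s \<Longrightarrow> s \<le> \<rho> \<Longrightarrow> norm x \<le> \<rho> \<Longrightarrow> norm y \<le> \<rho> \<Longrightarrow>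
       \<bar>g (s, x) - g (s, y)\<bar> \<le> M * norm (x - y) powr \<alpha>"
    using g_bounds by metis
  define d where "d = (e / (M + 1)) powr (1 / \<alpha>)"
  have d: "d powr \<alpha> = e / (M + 1)" "0 < d" using \<alpha> M assms by (auto simp: d_def powr_powr)
  show ?thesis
  proof (intro exI[of _ d] conjI ballI impI d)
    fix s :: real and x x' :: "real ^ 'd"
    assume *: "s \<in> {t0..\<rho>}" "x \<in> cball 0 \<rho>" "x' \<in> cball 0 \<rho>" "dist x x' < d"
    then have "\<bar>g (s, x) - g (s, x')\<bar> \<le> M * norm (x - x') powr \<alpha>" by (intro M) auto
    also have "\<dots> \<le> M * d powr \<alpha>"
      using * \<alpha> M(1) by (intro mult_left_mono powr_mono2) (auto simp: dist_norm)
    also have "\<dots> = e * (M / (M + 1))" by (simp add: d)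
    also have "\<dots> \<le> e * 1" using M(1) assms by (intro mult_left_mono) auto
    finally show "\<bar>g (s, x) - g (s, x')\<bar> \<le> e" by simp
  qed
qed

lemma g_cont: "t0 \<le> s \<Longrightarrow> continuous_on UNIV (\<lambda>x. g (s, x))"
  by (rule continuous_on_of_local_equicontinuity[where g = "\<lambda>s x. g (s, x)", OF g_equicontinuous])

lemma moved_dt_measurable: "moved_dt \<in> borel_measurable (lebesgue_on ({t0..} \<times> UNIV))"
proof -
  have S: "{t0..} \<times> (UNIV :: (real ^ 'd) set) \<in> sets lebesgue"
    by (rule lebesgue_set_Times_UNIV) simp
  have time: "(\<lambda>p::real \<times> (real ^ 'd). f (fst p)) \<in> borel_measurable (lebesgue_on ({t0..} \<times> UNIV))"
    if "f \<in> borel_measurable (lebesgue_on {t0..})" for f :: "real \<Rightarrow> 'e::euclidean_space"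
    by (rule measurable_time_function[OF that]) simp
  have cont: "f \<in> borel_measurable (lebesgue_on ({t0..} \<times> UNIV))"
    if "continuous_on ({t0..} \<times> UNIV) f" for f :: "real \<times> (real ^ 'd) \<Rightarrow> 'e::euclidean_space"
    by (rule continuous_imp_measurable_on_sets_lebesgue[OF that S])
  have "(\<lambda>p. g (fst p, snd p + B (fst p))) \<in> borel_measurable (lebesgue_on ({t0..} \<times> UNIV))"
    by (rule caratheodory_measurable[where h = "\<lambda>p y. g (fst p, y)"])
       (auto intro: time indefinite_integral_measurable[OF g_int] g_cont cont shift_cont)
  moreover have "(\<lambda>p. gradient (\<lambda>y. u (fst p, y)) (snd p + B (fst p))) \<in> borel_measurable (lebesgue_on ({t0..} \<times> UNIV))"
  proof (rule cont)
    show "continuous_on ({t0..} \<times> UNIV) (\<lambda>p. gradient (\<lambda>y. u (fst p, y)) (snd p + B (fst p)))"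
      by (rule continuous_on_compose2[OF gradient_cont, of _ "\<lambda>p. (fst p, snd p + B (fst p))", simplified])
         (auto intro!: continuous_intros shift_cont)
  qed
  moreover have "(\<lambda>p::real \<times> (real ^ 'd). b (fst p)) \<in> borel_measurable (lebesgue_on ({t0..} \<times> UNIV))"
    by (rule time[OF indefinite_integral_measurable[OF B]])
  moreover have "(\<lambda>p::real \<times> (real ^ 'd). \<psi> (fst p)) \<in> borel_measurable (lebesgue_on ({t0..} \<times> UNIV))"
    by (rule time[OF indefinite_integral_measurable[OF \<phi>]])
  moreover have "(\<lambda>p::real \<times> (real ^ 'd). \<phi> (fst p)) \<in> borel_measurable (lebesgue_on ({t0..} \<times> UNIV))"
    by (rule cont) (intro continuous_on_compose2[OF \<phi>_cont] continuous_intros, auto)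
  ultimately show ?thesis
    unfolding moved_dt_def first_order_op_eq_inner
    by (intro borel_measurable_add borel_measurable_times borel_measurable_inner cont[OF u_shift_cont])
qed

lemma moved_indefinite_integral:
  "indefinite_integral t0 (\<lambda>r. moved_dt (r, x)) (\<lambda>r. moved (r, x))"
proof -
  have Y: "indefinite_integral t0 b (\<lambda>r. x + B r)" by (rule indefinite_integral_shift[OF B])
  have bdd: "\<exists>M. \<forall>s\<in>{t0..\<rho>}. \<forall>x\<in>cball 0 \<rho>. \<bar>g (s, x)\<bar> \<le> M" for \<rho>
  proof -
    obtain M where "\<And>s x. t0 \<le> s \<Longrightarrow> s \<le> \<rho> \<Longrightarrow> norm x \<le> \<rho> \<Longrightarrow> \<bar>g (s, x)\<bar> \<le> M"
      using g_bounds[of \<rho>] by metis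
    then show ?thesis by (intro exI[of _ M]) auto
  qed
  note chain = indefinite_integral_chain[where U = "\<lambda>r y. u (r, y)" and g = "\<lambda>r y. g (r, y)"
      and D = "\<lambda>r y. gradient (\<lambda>y. u (r, y)) y", OF g_int has_derivative_gradient[OF u_diff(1)]
      gradient_cont bdd g_equicontinuous Y b]
  show ?thesis
    using indefinite_integral_mult[OF \<phi> \<psi> chain(2) chain(1)]
    by (simp add: moved_def moved_dt_def first_order_op_eq_inner)
qed

text \<open>
  No uniformity in \<open>s\<close> is lost although \<open>b\<close>, \<open>B\<close> and \<open>g\<close> are only locally bounded: the weight and
  its density vanish after \<open>t1\<close>, and up to \<open>t1\<close> the translates of a ball stay in a fixed larger ball.
\<close>

lemma moved_dt_local_bounds:
  "\<exists>M\<ge>0. \<forall>s\<ge>t0. \<forall>x\<in>cball 0 \<rho>. \<bar>moved_dt (s, x)\<bar> \<le> M \<and>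
        (\<forall>y\<in>cball 0 \<rho>. \<bar>moved_dt (s, x) - moved_dt (s, y)\<bar> \<le> M * norm (x - y) powr \<alpha>)"
proof -
  obtain MB where MB: "\<And>r. t0 \<le> r \<Longrightarrow> r \<le> t1 \<Longrightarrow> norm (B r) \<le> MB"
    using locally_bounded_fromE[OF locally_bounded_from_continuous[OF B_cont]] by metis
  obtain Mb where Mb: "0 < Mb" "\<And>r. t0 \<le> r \<Longrightarrow> r \<le> t1 \<Longrightarrow> norm (b r) \<le> Mb"
    using locally_bounded_fromE[OF b] by metis
  obtain P where P: "0 < P" "\<And>r. t0 \<le> r \<Longrightarrow> r \<le> t1 \<Longrightarrow> norm (\<phi> r) \<le> P"
    using locally_bounded_fromE[OF locally_bounded_from_continuous[OF \<phi>_cont]] by metis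
  obtain Q where Q: "0 < Q" "\<And>r. t0 \<le> r \<Longrightarrow> r \<le> t1 \<Longrightarrow> norm (\<psi> r) \<le> Q"
    using locally_bounded_fromE[OF \<psi>] by metis
  define \<rho>' where "\<rho>' = max t1 (\<rho> + MB)"
  obtain Mg where Mg: "0 \<le> Mg" "\<And>s x. t0 \<le> s \<Longrightarrow> s \<le> \<rho>' \<Longrightarrow> norm x \<le> \<rho>' \<Longrightarrow> \<bar>g (s, x)\<bar> \<le> Mg"
    "\<And>s x y. t0 \<le> s \<Longrightarrow> s \<le> \<rho>' \<Longrightarrow> norm x \<le> \<rho>' \<Longrightarrow> norm y \<le> \<rho>' \<Longrightarrow>
       \<bar>g (s, x) - g (s, y)\<bar> \<le> Mg * norm (x - y) powr \<alpha>"
    using g_bounds[of \<rho>'] by metis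
  obtain M where M: "0 \<le> M"
    "\<And>s x. s \<in> times_from (ereal t0) \<Longrightarrow> \<bar>u (s, x)\<bar> \<le> M"
    "\<And>s i x. s \<in> times_from (ereal t0) \<Longrightarrow> \<bar>pderivative i (\<lambda>y. u (s, y)) x\<bar> \<le> M"
    "\<And>s i j x. s \<in> times_from (ereal t0) \<Longrightarrow> \<bar>pderivative j (pderivative i (\<lambda>y. u (s, y))) x\<bar> \<le> M"
    using parabolic_space_bounds[OF u] by metis
  define H where "H = M * CARD('d) + 2 * M"
  have H: "0 \<le> H" "M \<le> H" using M(1) by (auto simp: H_def add_increasing add_increasing2)
  have uh: "\<bar>u (s, x) - u (s, y)\<bar> \<le> H * norm (x - y) powr \<alpha>" if "t0 \<le> s" for s x y
    unfolding H_def
    using holder_of_pderivative_bound[OF \<alpha> u_diff(1)[OF that], of M x y] M that by simp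
  have puh: "\<bar>pderivative i (\<lambda>y. u (s, y)) x - pderivative i (\<lambda>y. u (s, y)) y\<bar> \<le> H * norm (x - y) powr \<alpha>"
    if "t0 \<le> s" for s i x y
    unfolding H_def
    using holder_of_pderivative_bound[OF \<alpha> u_diff(2)[OF that], of i M x y] M that by simp
  have fo: "\<bar>first_order_op (b s) (\<lambda>y. u (s, y)) x\<bar> \<le> CARD('d) * (Mb * H)" if "t0 \<le> s" "s \<le> t1" for s x
  proof -
    have "\<bar>first_order_op (b s) (\<lambda>y. u (s, y)) x\<bar> \<le> (\<Sum>i\<in>(UNIV::'d set). Mb * H)"
      unfolding first_order_op_def
    proof (rule order_trans[OF sum_abs sum_mono])
      fix i
      have "\<bar>b s $ i\<bar> \<le> Mb" using component_le_norm_cart[of "b s" i] Mb(2)[OF that] by simp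
      moreover have "\<bar>pderivative i (\<lambda>y. u (s, y)) x\<bar> \<le> H" using M(3)[of s i x] that H by simp
      ultimately show "\<bar>b s $ i * pderivative i (\<lambda>y. u (s, y)) x\<bar> \<le> Mb * H"
        unfolding abs_mult using Mb(1) by (intro mult_mono) auto
    qed
    then show ?thesis by simp
  qed
  have foh: "\<bar>first_order_op (b s) (\<lambda>y. u (s, y)) x - first_order_op (b s) (\<lambda>y. u (s, y)) x'\<bar> \<le>
      CARD('d) * (Mb * H) * norm (x - x') powr \<alpha>" if "t0 \<le> s" "s \<le> t1" for s x x'
  proof -
    have "\<bar>first_order_op (b s) (\<lambda>y. u (s, y)) x - first_order_op (b s) (\<lambda>y. u (s, y)) x'\<bar> \<le>
        (\<Sum>i\<in>(UNIV::'d set). Mb * (H * norm (x - x') powr \<alpha>))"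
      unfolding first_order_op_def sum_subtractf[symmetric] right_diff_distrib[symmetric]
    proof (rule order_trans[OF sum_abs sum_mono])
      fix i
      have "\<bar>b s $ i\<bar> \<le> Mb" using component_le_norm_cart[of "b s" i] Mb(2)[OF that] by simp
      then show "\<bar>b s $ i * (pderivative i (\<lambda>y. u (s, y)) x - pderivative i (\<lambda>y. u (s, y)) x')\<bar> \<le>
          Mb * (H * norm (x - x') powr \<alpha>)"
        unfolding abs_mult using Mb(1) puh[OF that(1)] by (intro mult_mono) auto
    qed
    then show ?thesis by (simp add: mult_ac)
  qed
  define C where "C = P * (Mg + CARD('d) * (Mb * H)) + Q * H"
  have C: "0 \<le> C" using P(1) Q(1) Mg(1) Mb(1) H(1) by (auto simp: C_def)
  have "\<bar>moved_dt (s, x)\<bar> \<le> C \<and> (\<forall>y\<in>cball 0 \<rho>. \<bar>moved_dt (s, x) - moved_dt (s, y)\<bar> \<le> C * norm (x - y) powr \<alpha>)"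
    if s: "t0 \<le> s" and x: "x \<in> cball 0 \<rho>" for s x
  proof (cases "s \<le> t1")
    case False
    then show ?thesis using C t1[of s] by (simp add: moved_dt_def)
  next
    case True
    note sb = s True
    have sh: "norm (y + B s) \<le> \<rho>'" if "y \<in> cball 0 \<rho>" for y
      using that MB[OF sb] norm_triangle_ineq[of y "B s"] by (auto simp: \<rho>'_def)
    have s': "s \<le> \<rho>'" using True by (simp add: \<rho>'_def)
    have lin: "\<bar>\<phi> s * (a1 + a2) + \<psi> s * a3\<bar> \<le> P * (A1 + A2) + Q * A3"
      if "\<bar>a1\<bar> \<le> A1" "\<bar>a2\<bar> \<le> A2" "\<bar>a3\<bar> \<le> A3" for a1 a2 a3 A1 A2 A3
    proof -
      have "\<bar>\<phi> s * (a1 + a2)\<bar> \<le> P * (A1 + A2)"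
        unfolding abs_mult using P(1) P(2)[OF sb] that by (intro mult_mono) auto
      moreover have "\<bar>\<psi> s * a3\<bar> \<le> Q * A3"
        unfolding abs_mult using Q(1) Q(2)[OF sb] that by (intro mult_mono) auto
      ultimately show ?thesis by linarith
    qed
    have "\<bar>moved_dt (s, x)\<bar> \<le> C"
      unfolding moved_dt_def C_def fst_conv snd_conv
      using M(2)[of s "x + B s"] s H(2)
      by (intro lin Mg(2) s s' sh x fo True) auto
    moreover have "\<bar>moved_dt (s, x) - moved_dt (s, y)\<bar> \<le> C * norm (x - y) powr \<alpha>" if y: "y \<in> cball 0 \<rho>" for y
    proof -
      define D where "D = norm (x - y) powr \<alpha>"
      define xx yy where "xx = x + B s" and "yy = y + B s"
      have n: "norm (xx - yy) = norm (x - y)" by (simp add: xx_def yy_def)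
      have "moved_dt (s, x) - moved_dt (s, y) =
         \<phi> s * ((g (s, xx) - g (s, yy)) +
           (first_order_op (b s) (\<lambda>y. u (s, y)) xx - first_order_op (b s) (\<lambda>y. u (s, y)) yy))
         + \<psi> s * (u (s, xx) - u (s, yy))"
        by (simp add: moved_dt_def xx_def yy_def algebra_simps)
      also have "\<bar>\<dots>\<bar> \<le> P * (Mg * D + CARD('d) * (Mb * H) * D) + Q * (H * D)"
        using Mg(3)[OF s s' sh[OF x] sh[OF y]] foh[OF sb, of xx yy] uh[OF s, of xx yy] n
        by (intro lin) (auto simp: D_def xx_def yy_def)
      also have "\<dots> = C * D" by (simp add: C_def algebra_simps)
      finally show ?thesis by (simp add: D_def)
    qed
    ultimately show ?thesis by blast
  qed
  then show ?thesis using C by blast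
qed

lemma moved_is_time_derivative: "is_time_derivative \<alpha> (ereal t0) moved moved_dt"
  by (rule is_time_derivativeI[OF \<alpha> moved_dt_measurable moved_indefinite_integral moved_dt_local_bounds])

lemma moved_section: "(\<lambda>x. moved (s, x)) = (\<lambda>x. \<phi> s * u (s, x + B s))"
  by (simp add: moved_def)

lemma moved_parabolic_space: "moved \<in> parabolic_space \<alpha> (ereal t0)"
proof -
  have "(\<lambda>x. moved (s, x)) \<in> holder2_space \<alpha>" if "t0 \<le> s" for s
    unfolding moved_section using u that
    by (intro holder2_space_affine[where f = "\<lambda>x. u (s, x)"]) (auto simp: parabolic_space_def)
  moreover have "(SUP s\<in>{t0..}. holder2_norm \<alpha> (\<lambda>x. moved (s, x))) < \<infinity>"
  proof -
    define S where "S = (SUP s\<in>{t0..}. holder2_norm \<alpha> (\<lambda>x. u (s, x)))"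
    have S: "S < \<infinity>" using u by (simp add: parabolic_space_def S_def)
    obtain P where P: "0 < P" "\<And>r. t0 \<le> r \<Longrightarrow> r \<le> t1 \<Longrightarrow> norm (\<phi> r) \<le> P"
      using locally_bounded_fromE[OF locally_bounded_from_continuous[OF \<phi>_cont]] by metis
    have P': "\<bar>\<phi> r\<bar> \<le> P" if "t0 \<le> r" for r
      using P(2)[of r] t1(1)[of r] P(1) that by (cases "r \<le> t1") auto
    have "holder2_norm \<alpha> (\<lambda>x. moved (s, x)) \<le> ennreal P * S" if s: "t0 \<le> s" for s
    proof -
      have "holder2_norm \<alpha> (\<lambda>x. moved (s, x)) \<le> ennreal \<bar>\<phi> s\<bar> * holder2_norm \<alpha> (\<lambda>x. u (s, x))"
        unfolding moved_section by (rule holder2_norm_affine) (use u_diff s in auto)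
      also have "\<dots> \<le> ennreal P * S"
        unfolding S_def using s P'[OF s] by (intro mult_mono ennreal_leI SUP_upper) auto
      finally show ?thesis .
    qed
    then have "(SUP s\<in>{t0..}. holder2_norm \<alpha> (\<lambda>x. moved (s, x))) \<le> ennreal P * S"
      by (intro SUP_least) auto
    also have "\<dots> < \<infinity>" using S by (simp add: ennreal_mult_less_top)
    finally show ?thesis .
  qed
  ultimately show ?thesis
    using moved_cont moved_is_time_derivative
    by (auto simp: parabolic_space_def spacetime_ereal)
qed

lemma moved_parabolic_space0:
  assumes R: "\<And>s x. t0 \<le> s \<Longrightarrow> R \<le> norm x \<Longrightarrow> u (s, x) = 0"
  shows "moved \<in> parabolic_space0 \<alpha> (ereal t0)"
proof -
  obtain MB where MB: "\<And>r. t0 \<le> r \<Longrightarrow> r \<le> t1 \<Longrightarrow> norm (B r) \<le> MB"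
    using locally_bounded_fromE[OF locally_bounded_from_continuous[OF B_cont]] by metis
  have "moved (s, x) = 0" if s: "t0 \<le> s" and sx: "R + MB + \<bar>t0\<bar> + \<bar>t1\<bar> \<le> norm x + \<bar>s\<bar>" for s x
  proof (cases "s \<le> t1")
    case True
    then have "R + norm (B s) \<le> norm x" using MB[OF s True] s sx by linarith
    then have "R \<le> norm (x + B s)" using norm_triangle_ineq4[of "x + B s" "B s"] by simp
    then show ?thesis using R s by (simp add: moved_def)
  qed (simp add: moved_def t1)
  then show ?thesis
    using moved_parabolic_space
    by (auto simp: parabolic_space0_def intro!: exI[of _ "R + MB + \<bar>t0\<bar> + \<bar>t1\<bar>"])
qed

text \<open>
  The second order operator commutes with translations in space and with multiplication by functions of time,
  because its coefficients do not depend on \<open>x\<close>.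
\<close>

lemma moved_operator:
  assumes "t0 \<le> s"
  shows "moved_dt (s, x) + second_order_op A (\<lambda>y. moved (s, y)) x =
    \<phi> s * (g (s, x + B s) + second_order_op A (\<lambda>y. u (s, y)) (x + B s)
      + first_order_op (b s) (\<lambda>y. u (s, y)) (x + B s)) + \<psi> s * u (s, x + B s)"
proof -
  have "second_order_op A (\<lambda>y. moved (s, y)) x = \<phi> s * second_order_op A (\<lambda>y. u (s, y)) (x + B s)"
    unfolding moved_section
    by (rule second_order_op_affine[where f = "\<lambda>y. u (s, y)"]) (rule u_diff[OF assms])+
  then show ?thesis by (simp add: moved_dt_def algebra_simps)
qed

end

section \<open>The estimate with lower order terms\<close>

lemma times_after_ereal [simp]: "times_after (ereal t) = {t<..}"
  by (auto simp: times_after_def)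

lemma times_from_mono: "t \<in> times_from T \<Longrightarrow> {t..} \<subseteq> times_from T"
  by (auto simp: times_from_def intro: order_trans)

lemma times_after_mono: "t \<in> times_from T \<Longrightarrow> {t<..} \<subseteq> times_after T"
  by (auto simp: times_from_def times_after_def intro: le_less_trans)

lemma is_time_derivative_restrict:
  fixes g :: "real \<times> (real ^ 'd::finite) \<Rightarrow> real"
  assumes g: "is_time_derivative \<alpha> T u g" and t: "t \<in> times_from T"
  shows "is_time_derivative \<alpha> (ereal t) u g"
proof -
  note sub = times_from_mono[OF t]
  then have sub': "spacetime (ereal t) \<subseteq> (spacetime T :: (real \<times> (real ^ 'd)) set)"
    by (auto simp: spacetime_def)
  have "g \<in> borel_measurable (lebesgue_on (spacetime (ereal t)))"
    using g sub' by (auto simp: is_time_derivative_def intro: measurable_restrict_mono)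
  moreover have "bounded ((\<lambda>p. z p * g p) ` spacetime (ereal t)) \<and>
      (SUP s\<in>{t..}. holder_seminorm \<alpha> (\<lambda>x. z (s, x) * g (s, x))) < \<infinity>" if z: "z \<in> test_functions" for z
  proof -
    have "bounded ((\<lambda>p. z p * g p) ` spacetime T)"
      "(SUP s\<in>times_from T. holder_seminorm \<alpha> (\<lambda>x. z (s, x) * g (s, x))) < \<infinity>"
      using g z by (auto simp: is_time_derivative_def)
    then show ?thesis
      using bounded_subset[OF _ image_mono[OF sub']] le_less_trans[OF SUP_subset_mono[OF sub order_refl]] by blast
  qed
  moreover have "set_integrable lebesgue {s..r} (\<lambda>r. g (r, x)) \<and>
      u (r, x) - u (s, x) = (LINT r:{s..r}|lebesgue. g (r, x))" if "t \<le> s" "s < r" for x s r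
    using g sub that by (auto simp: is_time_derivative_def)
  ultimately show ?thesis
    unfolding is_time_derivative_def by simp
qed

lemma parabolic_space_restrict:
  assumes u: "u \<in> parabolic_space \<alpha> T" and t: "t \<in> times_from T"
  shows "u \<in> parabolic_space \<alpha> (ereal t)"
proof -
  note sub = times_from_mono[OF t]
  have "continuous_on (spacetime (ereal t)) u"
    using u sub by (auto simp: parabolic_space_def spacetime_def intro: continuous_on_subset)
  moreover have "(SUP s\<in>{t..}. holder2_norm \<alpha> (\<lambda>x. u (s, x))) < \<infinity>"
    by (rule le_less_trans[OF SUP_subset_mono[OF sub order_refl]]) (use u in \<open>simp add: parabolic_space_def\<close>)
  moreover have "\<exists>g. is_time_derivative \<alpha> (ereal t) u g"
    using u is_time_derivative_restrict[OF _ t] by (auto simp: parabolic_space_def)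
  ultimately show ?thesis
    using u sub by (auto simp: parabolic_space_def)
qed

lemma admissible_coeffs_restrict:
  assumes a: "admissible_coeffs \<delta> K T a" and t: "t \<in> times_from T"
  shows "admissible_coeffs \<delta> K (ereal t) a"
proof -
  note sub = times_after_mono[OF t]
  have "a \<in> borel_measurable (lebesgue_on {t<..})"
    using a sub by (auto simp: admissible_coeffs_def intro: measurable_restrict_mono)
  then show ?thesis
    using a sub by (auto simp: admissible_coeffs_def)
qed

text \<open>
  The coefficients are defined only for times after \<open>T\<close>, so their value at \<open>t\<close> may be meaningless when
  \<open>t = T\<close>; the value \<open>0\<close> there does not change their integrals and gives bounds on closed intervals.
\<close>

lemma zero_extension:
  fixes f :: "real \<Rightarrow> 'a::euclidean_space"
  assumes "f \<in> borel_measurable (lebesgue_on (times_after T))" "locally_bounded_after T f" "t \<in> times_from T"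
  shows "(\<lambda>s. if s \<in> {t<..} then f s else 0) \<in> borel_measurable (lebesgue_on {t..})"
    and "locally_bounded_from t (\<lambda>s. if s \<in> {t<..} then f s else 0)"
proof -
  note sub = times_after_mono[OF assms(3)]
  have "f \<in> borel_measurable (lebesgue_on {t<..})"
    by (rule measurable_restrict_mono[OF assms(1) sub])
  then have "(\<lambda>s. if s \<in> {t<..} then f s else 0) \<in> borel_measurable lebesgue"
    by (subst borel_measurable_if) auto
  then show "(\<lambda>s. if s \<in> {t<..} then f s else 0) \<in> borel_measurable (lebesgue_on {t..})"
    by (rule measurable_restrict_space1)
  show "locally_bounded_from t (\<lambda>s. if s \<in> {t<..} then f s else 0)"
    unfolding locally_bounded_from_def
  proof
    fix q
    have "bounded (insert 0 (f ` (times_after T \<inter> {t..q})))"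
      using assms(2) by (simp add: locally_bounded_after_def)
    then show "bounded ((\<lambda>s. if s \<in> {t<..} then f s else 0) ` {t..q})"
      by (rule bounded_subset) (use sub in auto)
  qed
qed

text \<open>
  A piecewise linear cutoff suffices, since weights need only be absolutely continuous.
\<close>

lemma linear_cutoff_indefinite_integral:
  fixes \<epsilon> t :: real
  assumes \<epsilon>: "0 < \<epsilon>"
  shows "indefinite_integral t (\<lambda>s. if s < t + 1 / \<epsilon> then - \<epsilon> else 0) (\<lambda>s. max 0 (1 - \<epsilon> * (s - t)))"
    (is "indefinite_integral t ?f ?F")
  unfolding indefinite_integral_def
proof (intro allI impI conjI)
  fix r s assume rs: "t \<le> r" "r < s"
  have meas: "?f \<in> borel_measurable (lebesgue_on {t..})"
    by (intro measurable_restrict_space1 measurable_completion) measurable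
  have "locally_bounded_from t ?f"
    by (rule locally_bounded_fromI) (use \<epsilon> in \<open>auto intro!: exI[of _ \<epsilon>]\<close>)
  then show "?f absolutely_integrable_on {r..s}"
    using rs by (intro absolutely_integrable_locally_bounded[OF meas])
  have "(?f has_integral (?F s - ?F r)) {r..s}"
  proof (rule fundamental_theorem_of_calculus_strong[of "{t + 1 / \<epsilon>}"])
    fix x assume x: "x \<in> {r..s} - {t + 1 / \<epsilon>}"
    consider "x < t + 1 / \<epsilon>" | "t + 1 / \<epsilon> < x" using x by fastforce
    then show "(?F has_vector_derivative ?f x) (at x)"
    proof cases
      case 1
      have "((\<lambda>s. 1 - \<epsilon> * (s - t)) has_vector_derivative - \<epsilon>) (at x)"
        by (auto intro!: derivative_eq_intros simp: has_real_derivative_iff_has_vector_derivative[symmetric])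
      then have "(?F has_vector_derivative - \<epsilon>) (at x)"
        by (rule has_vector_derivative_transform_within_open[where S = "{..<t + 1 / \<epsilon>}"])
           (use 1 \<epsilon> in \<open>auto simp: field_simps\<close>)
      then show ?thesis using 1 by simp
    next
      case 2
      have "((\<lambda>s. 0) has_vector_derivative 0) (at x)" by (rule has_vector_derivative_const)
      then have "(?F has_vector_derivative 0) (at x)"
        by (rule has_vector_derivative_transform_within_open[where S = "{t + 1 / \<epsilon><..}"])
           (use 2 \<epsilon> in \<open>auto simp: field_simps\<close>)
      then show ?thesis using 2 by simp
    qed
  qed (use rs in \<open>auto intro!: continuous_intros\<close>)
  then show "?F s - ?F r = integral {r..s} ?f" by (simp add: integral_unique)
qed

text \<open>
  The basic estimate on \<open>[t, \<infinity>)\<close> for the translate of \<open>u\<close> with weight \<open>\<eta> s * exp (- C s)\<close>. At time \<open>t\<close> the weight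
  is \<open>1\<close> and the translation is \<open>0\<close>, so the left-hand side is the one for \<open>u\<close>. On the right the potential
  contributes the term \<open>- c\<^sub>0 u\<close> through the derivative of \<open>exp (- C)\<close> and otherwise only a factor at most \<open>1\<close>.
\<close>

lemma estimate_with_drift_and_potential:
  fixes u g :: "real \<times> (real ^ 'd::finite) \<Rightarrow> real" and a :: "real \<Rightarrow> real ^ 'd ^ 'd"
  assumes \<alpha>: "0 < \<alpha>" "\<alpha> < 1"
    and N: "basic_estimate TYPE('d) \<delta> \<alpha> N" and K: "0 < K" and a: "admissible_coeffs \<delta> K T a"
    and t: "t \<in> times_from T"
    and u: "u \<in> parabolic_space \<alpha> T" and g: "is_time_derivative \<alpha> T u g"
    and R: "\<And>s x. s \<in> times_from T \<Longrightarrow> R \<le> norm x \<Longrightarrow> u (s, x) = 0"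
    and c\<^sub>0: "c\<^sub>0 \<in> borel_measurable (lebesgue_on (times_after T))" "locally_bounded_after T c\<^sub>0"
      "\<And>s. s \<in> times_after T \<Longrightarrow> 0 \<le> c\<^sub>0 s"
    and b\<^sub>0: "b\<^sub>0 \<in> borel_measurable (lebesgue_on (times_after T))" "locally_bounded_after T b\<^sub>0"
  shows "holder2_seminorm \<alpha> (\<lambda>x. u (t, x))
          \<le> ennreal N * (SUP s\<in>{t<..}. holder_seminorm \<alpha>
               (\<lambda>x. g (s, x) + second_order_op (a s) (\<lambda>y. u (s, y)) x
                  + first_order_op (b\<^sub>0 s) (\<lambda>y. u (s, y)) x - c\<^sub>0 s * u (s, x)))"
    (is "?X \<le> ennreal N * ?S")
proof -
  let ?f = "\<lambda>s x. g (s, x) + second_order_op (a s) (\<lambda>y. u (s, y)) x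
                  + first_order_op (b\<^sub>0 s) (\<lambda>y. u (s, y)) x - c\<^sub>0 s * u (s, x)"
  define b where "b = (\<lambda>s. if s \<in> {t<..} then b\<^sub>0 s else 0)"
  define c where "c = (\<lambda>s. if s \<in> {t<..} then c\<^sub>0 s else 0)"
  define B where "B = (\<lambda>s. integral {t..s} b)"
  define C where "C = (\<lambda>s. integral {t..s} c)"
  have b: "locally_bounded_from t b" and B: "indefinite_integral t b B"
    unfolding B_def b_def using zero_extension[OF b\<^sub>0 t] by (auto intro: integral_indefinite_integral)
  have c: "locally_bounded_from t c" and C: "indefinite_integral t c C"
    unfolding C_def c_def using zero_extension[OF c\<^sub>0(1,2) t] by (auto intro: integral_indefinite_integral)
  have C0: "0 \<le> C s" for s
    unfolding C_def
  proof (rule Henstock_Kurzweil_Integration.integral_nonneg)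
    show "c integrable_on {t..s}"
      by (intro set_lebesgue_integral_eq_integral(1)
          absolutely_integrable_locally_bounded[OF indefinite_integral_measurable[OF C] c]) auto
  qed (use times_after_mono[OF t] in \<open>auto simp: c_def c\<^sub>0(3)\<close>)
  have expC: "indefinite_integral t (\<lambda>s. - (c s * exp (- C s))) (\<lambda>s. exp (- C s))"
    by (rule indefinite_integral_exp[OF C c])
  have Ccont: "continuous_on {t..} (\<lambda>s. exp (- C s))"
    by (intro continuous_intros indefinite_integral_continuous[OF C c])
  have expb: "locally_bounded_from t (\<lambda>s. exp (- C s))"
    by (rule locally_bounded_from_continuous[OF Ccont])
  have expb': "locally_bounded_from t (\<lambda>s. - (c s * exp (- C s)))"
    using locally_bounded_from_mult[OF c expb] by (simp add: locally_bounded_from_def bounded_iff)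
  note ut = parabolic_space_restrict[OF u t] and gt = is_time_derivative_restrict[OF g t]
  obtain M where M: "0 \<le> M"
    "\<And>s x. s \<in> times_from T \<Longrightarrow> \<bar>u (s, x)\<bar> \<le> M"
    "\<And>s i x. s \<in> times_from T \<Longrightarrow> \<bar>pderivative i (\<lambda>y. u (s, y)) x\<bar> \<le> M"
    using parabolic_space_bounds[OF u] by metis
  define H where "H = M * CARD('d) + 2 * M"
  have H: "0 \<le> H" using M(1) by (simp add: H_def)
  have uh: "holder_seminorm \<alpha> (\<lambda>x. u (s, x)) \<le> ennreal H" if s: "s \<in> times_from T" for s
  proof -
    have "\<bar>u (s, x) - u (s, y)\<bar> \<le> H * norm (x - y) powr \<alpha>" for x y
      unfolding H_def
      using holder_of_pderivative_bound[OF \<alpha>(1) _ parabolic_space_differentiable(1)[OF u s], of M x y] M s \<alpha>(2)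
      by simp
    then show ?thesis using H by (subst holder_seminorm_le_iff) auto
  qed
  \<comment> \<open>The error is the seminorm of \<open>\<eta>' * exp (- C) * u\<close>, where \<open>\<eta>'\<close> is the slope of the cutoff.\<close>
  have eps: "?X \<le> ennreal N * (?S + ennreal (\<epsilon> * H))" if \<epsilon>: "0 < \<epsilon>" for \<epsilon>
  proof -
    define \<eta> where "\<eta> = (\<lambda>s. max 0 (1 - \<epsilon> * (s - t)))"
    define \<eta>' where "\<eta>' = (\<lambda>s. if s < t + 1 / \<epsilon> then - \<epsilon> else 0)"
    have \<eta>: "indefinite_integral t \<eta>' \<eta>"
      unfolding \<eta>_def \<eta>'_def by (rule linear_cutoff_indefinite_integral[OF \<epsilon>])
    have \<eta>b: "locally_bounded_from t \<eta>'"
      by (rule locally_bounded_fromI) (use \<epsilon> in \<open>auto simp: \<eta>'_def intro!: exI[of _ \<epsilon>]\<close>)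
    define \<phi> where "\<phi> = (\<lambda>s. \<eta> s * exp (- C s))"
    define \<psi> where "\<psi> = (\<lambda>s. \<eta> s * - (c s * exp (- C s)) + \<eta>' s * exp (- C s))"
    have \<phi>: "indefinite_integral t \<psi> \<phi>"
      unfolding \<phi>_def \<psi>_def by (rule indefinite_integral_mult[OF \<eta> \<eta>b expC expb'])
    have \<psi>: "locally_bounded_from t \<psi>"
      unfolding \<psi>_def
      by (intro locally_bounded_from_add locally_bounded_from_mult expb expb' \<eta>b
          locally_bounded_from_continuous indefinite_integral_continuous[OF \<eta> \<eta>b])
    have \<eta>0: "\<eta> r = 0" "\<eta>' r = 0" if "t + 1 / \<epsilon> \<le> r" for r
      using that \<epsilon> by (auto simp: \<eta>_def \<eta>'_def field_simps)
    interpret moving_frame \<alpha> t "t + 1 / \<epsilon>" u g b B \<psi> \<phi>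
      by unfold_locales (use \<alpha> ut gt B b \<phi> \<psi> \<eta>0 in \<open>auto simp: \<phi>_def \<psi>_def\<close>)
    have "moved \<in> parabolic_space0 \<alpha> (ereal t)"
      using R times_from_mono[OF t] by (intro moved_parabolic_space0[of R]) auto
    then have "holder2_seminorm \<alpha> (\<lambda>x. moved (t, x)) \<le> ennreal N * (SUP r\<in>{t<..}. holder_seminorm \<alpha>
               (\<lambda>x. moved_dt (r, x) + second_order_op (a r) (\<lambda>y. moved (r, y)) x))"
      using N[unfolded basic_estimate_def, rule_format, of "ereal t" K a moved moved_dt t]
        K admissible_coeffs_restrict[OF a t] moved_is_time_derivative by simp
    moreover have "moved (t, x) = u (t, x)" for x
    proof -
      have "\<phi> t = 1" "B t = 0" by (simp_all add: \<phi>_def \<eta>_def C_def B_def)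
      then show ?thesis by (simp add: moved_def)
    qed
    moreover have "(SUP r\<in>{t<..}. holder_seminorm \<alpha>
               (\<lambda>x. moved_dt (r, x) + second_order_op (a r) (\<lambda>y. moved (r, y)) x)) \<le> ?S + ennreal (\<epsilon> * H)"
    proof (rule SUP_least)
      fix r assume r: "r \<in> {t<..}"
      then have rT: "r \<in> times_from T" using times_from_mono[OF t] by auto
      have "moved_dt (r, x) + second_order_op (a r) (\<lambda>y. moved (r, y)) x =
          \<phi> r *\<^sub>R ?f r (x + B r) + (\<eta>' r * exp (- C r)) *\<^sub>R u (r, x + B r)" for x
        using r by (subst moved_operator) (auto simp: \<psi>_def \<phi>_def b_def c_def algebra_simps)
      then have "holder_seminorm \<alpha> (\<lambda>x. moved_dt (r, x) + second_order_op (a r) (\<lambda>y. moved (r, y)) x)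
        \<le> holder_seminorm \<alpha> (\<lambda>x. \<phi> r *\<^sub>R ?f r (x + B r))
          + holder_seminorm \<alpha> (\<lambda>x. (\<eta>' r * exp (- C r)) *\<^sub>R u (r, x + B r))"
        by (simp only: holder_seminorm_add)
      also have "\<dots> \<le> ennreal \<bar>\<phi> r\<bar> * holder_seminorm \<alpha> (?f r)
          + ennreal \<bar>\<eta>' r * exp (- C r)\<bar> * holder_seminorm \<alpha> (\<lambda>x. u (r, x))"
        by (intro add_mono holder_seminorm_affine)
      also have "\<dots> \<le> 1 * ?S + ennreal \<epsilon> * ennreal H"
      proof (intro add_mono mult_mono)
        have e: "exp (- C r) \<le> 1" using C0[of r] by simp
        have "\<bar>\<eta> r\<bar> \<le> 1" using r \<epsilon> by (auto simp: \<eta>_def)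
        then have "\<bar>\<phi> r\<bar> \<le> 1"
          using e mult_mono[of "\<bar>\<eta> r\<bar>" 1 "exp (- C r)" 1] by (simp add: \<phi>_def abs_mult)
        then show "ennreal \<bar>\<phi> r\<bar> \<le> 1" using ennreal_leI by fastforce
        have "\<bar>\<eta>' r\<bar> \<le> \<epsilon>" using \<epsilon> by (auto simp: \<eta>'_def)
        then have "\<bar>\<eta>' r * exp (- C r)\<bar> \<le> \<epsilon>"
          using e mult_mono[of "\<bar>\<eta>' r\<bar>" \<epsilon> "exp (- C r)" 1] \<epsilon> by (simp add: abs_mult)
        then show "ennreal \<bar>\<eta>' r * exp (- C r)\<bar> \<le> ennreal \<epsilon>" by (rule ennreal_leI)
        show "holder_seminorm \<alpha> (?f r) \<le> ?S" by (rule SUP_upper[OF r])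
        show "holder_seminorm \<alpha> (\<lambda>x. u (r, x)) \<le> ennreal H" by (rule uh[OF rT])
      qed auto
      also have "\<dots> = ?S + ennreal (\<epsilon> * H)" using \<epsilon> H by (simp add: ennreal_mult)
      finally show "holder_seminorm \<alpha> (\<lambda>x. moved_dt (r, x) + second_order_op (a r) (\<lambda>y. moved (r, y)) x)
        \<le> ?S + ennreal (\<epsilon> * H)" .
    qed
    ultimately show ?thesis
      by (simp only:) (meson mult_left_mono order_trans zero_le)
  qed
  show ?thesis
  proof (rule ennreal_le_epsilon)
    fix e :: real assume e: "0 < e"
    \<comment> \<open>The choice ensures \<open>\<bar>N\<bar> * (\<epsilon> * H) \<le> e\<close>; the absolute value allows for negative \<open>N\<close>.\<close>
    define \<epsilon> where "\<epsilon> = e / (\<bar>N\<bar> * H + 1)"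
    have pos: "0 < \<bar>N\<bar> * H + 1" using H by (intro add_nonneg_pos) auto
    then have \<epsilon>: "0 < \<epsilon>" using e by (simp add: \<epsilon>_def)
    have "\<bar>N\<bar> * (\<epsilon> * H) = e * ((\<bar>N\<bar> * H) / (\<bar>N\<bar> * H + 1))" by (simp add: \<epsilon>_def)
    also have "\<dots> \<le> e * 1" using e pos by (intro mult_left_mono) auto
    finally have le: "\<bar>N\<bar> * (\<epsilon> * H) \<le> e" by simp
    have "ennreal N * ennreal (\<epsilon> * H) \<le> ennreal \<bar>N\<bar> * ennreal (\<epsilon> * H)"
      by (intro mult_right_mono ennreal_leI) auto
    also have "\<dots> = ennreal (\<bar>N\<bar> * (\<epsilon> * H))" using \<epsilon> H by (intro ennreal_mult[symmetric]) auto
    also have "\<dots> \<le> ennreal e" by (rule ennreal_leI[OF le])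
    finally have "ennreal N * ?S + ennreal N * ennreal (\<epsilon> * H) \<le> ennreal N * ?S + ennreal e"
      by (rule add_left_mono)
    with eps[OF \<epsilon>] show "?X \<le> ennreal N * ?S + ennreal e"
      unfolding distrib_left by (rule order_trans)
  qed
qed

lemma stationary_is_time_derivative:
  fixes u :: "real ^ 'd::finite \<Rightarrow> real"
  shows "is_time_derivative \<alpha> T (\<lambda>p. u (snd p)) (\<lambda>_. 0)"
proof -
  have z: "holder_seminorm \<alpha> (\<lambda>x::real ^ 'd. 0 :: real) \<le> 0"
    using holder_seminorm_le_iff[of 0 \<alpha> "\<lambda>x::real ^ 'd. 0 :: real"] by simp
  have "(SUP t\<in>times_from T. holder_seminorm \<alpha> (\<lambda>x::real ^ 'd. 0 :: real)) < \<infinity>"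
    by (rule le_less_trans[OF SUP_least[where u = 0]]) (use z in auto)
  then show ?thesis
    by (auto simp: is_time_derivative_def set_integrable_def set_lebesgue_integral_def bounded_iff)
qed

lemma stationary_parabolic_space:
  assumes "u \<in> holder2_space \<alpha>"
  shows "(\<lambda>p. u (snd p)) \<in> parabolic_space \<alpha> T"
proof -
  have "continuous_on UNIV u"
    using assms by (auto simp: holder2_space_def intro!: continuous_at_imp_continuous_on differentiable_imp_continuous_within)
  then have "continuous_on (spacetime T) (\<lambda>p. u (snd p))"
    by (rule continuous_on_compose2) (auto intro!: continuous_intros)
  moreover have "(SUP t\<in>times_from T. holder2_norm \<alpha> u) < \<infinity>"
    using assms by (intro le_less_trans[OF SUP_least, of _ _ "holder2_norm \<alpha> u"]) (auto simp: holder2_space_def)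
  ultimately show ?thesis
    using assms stationary_is_time_derivative by (auto simp: parabolic_space_def)
qed

theorem lemma3p10:
  fixes \<delta> \<alpha> N K :: real and T :: ereal and a :: "real \<Rightarrow> real ^ 'd ^ 'd::finite"
  assumes "0 < \<delta>" and "0 < \<alpha>" and "\<alpha> < 1"
    and "basic_estimate TYPE('d) \<delta> \<alpha> N"
    and "T \<noteq> \<infinity>" and "0 < K"
    and "admissible_coeffs \<delta> K T a"
  shows
    "(\<forall>(u :: real \<times> (real ^ 'd) \<Rightarrow> real) u\<^sub>t. \<forall>t\<in>times_from T.
        \<forall>(c\<^sub>0 :: real \<Rightarrow> real) (b\<^sub>0 :: real \<Rightarrow> real ^ 'd).
        u \<in> parabolic_space \<alpha> T \<longrightarrow> is_time_derivative \<alpha> T u u\<^sub>t \<longrightarrow>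
        (\<exists>R>0. \<forall>s\<in>times_from T. \<forall>x. R \<le> norm x \<longrightarrow> u (s, x) = 0) \<longrightarrow>
        c\<^sub>0 \<in> borel_measurable (lebesgue_on (times_after T)) \<longrightarrow>
        locally_bounded_after T c\<^sub>0 \<longrightarrow> (\<forall>s\<in>times_after T. 0 \<le> c\<^sub>0 s) \<longrightarrow>
        b\<^sub>0 \<in> borel_measurable (lebesgue_on (times_after T)) \<longrightarrow>
        locally_bounded_after T b\<^sub>0 \<longrightarrow>
        holder2_seminorm \<alpha> (\<lambda>x. u (t, x))
          \<le> ennreal N * (SUP s\<in>{t<..}. holder_seminorm \<alpha>
               (\<lambda>x. u\<^sub>t (s, x) + second_order_op (a s) (\<lambda>y. u (s, y)) x
                  + first_order_op (b\<^sub>0 s) (\<lambda>y. u (s, y)) x - c\<^sub>0 s * u (s, x)))) \<and>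
     (\<forall>A. (\<forall>t\<in>times_after T. a t = A) \<longrightarrow>
        (\<forall>(u :: real ^ 'd \<Rightarrow> real) (c\<^sub>0 :: real) (b\<^sub>0 :: real ^ 'd).
           u \<in> holder2_space \<alpha> \<longrightarrow> compact (closure {x. u x \<noteq> 0}) \<longrightarrow> 0 \<le> c\<^sub>0 \<longrightarrow>
           holder2_seminorm \<alpha> u
             \<le> ennreal N * holder_seminorm \<alpha>
                  (\<lambda>x. second_order_op A u x + first_order_op b\<^sub>0 u x - c\<^sub>0 * u x)))"
proof (intro conjI allI ballI impI)
  fix u g :: "real \<times> (real ^ 'd) \<Rightarrow> real" and t and c\<^sub>0 :: "real \<Rightarrow> real" and b\<^sub>0 :: "real \<Rightarrow> real ^ 'd"
  assume t: "t \<in> times_from T" and u: "u \<in> parabolic_space \<alpha> T" "is_time_derivative \<alpha> T u g"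
    and "\<exists>R>0. \<forall>s\<in>times_from T. \<forall>x. R \<le> norm x \<longrightarrow> u (s, x) = 0"
    and c: "c\<^sub>0 \<in> borel_measurable (lebesgue_on (times_after T))" "locally_bounded_after T c\<^sub>0"
      "\<forall>s\<in>times_after T. 0 \<le> c\<^sub>0 s"
    and b: "b\<^sub>0 \<in> borel_measurable (lebesgue_on (times_after T))" "locally_bounded_after T b\<^sub>0"
  then obtain R where R: "\<And>s x. s \<in> times_from T \<Longrightarrow> R \<le> norm x \<Longrightarrow> u (s, x) = 0" by blast
  show "holder2_seminorm \<alpha> (\<lambda>x. u (t, x))
          \<le> ennreal N * (SUP s\<in>{t<..}. holder_seminorm \<alpha>
               (\<lambda>x. g (s, x) + second_order_op (a s) (\<lambda>y. u (s, y)) x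
                  + first_order_op (b\<^sub>0 s) (\<lambda>y. u (s, y)) x - c\<^sub>0 s * u (s, x)))"
    using estimate_with_drift_and_potential[OF assms(2-4,6,7) t u R c(1,2) _ b] c(3) by blast
next
  fix A and u :: "real ^ 'd \<Rightarrow> real" and c\<^sub>0 :: real and b\<^sub>0 :: "real ^ 'd"
  assume A: "\<forall>t\<in>times_after T. a t = A" and u: "u \<in> holder2_space \<alpha>"
    and supp: "compact (closure {x. u x \<noteq> 0})" and c: "0 \<le> c\<^sub>0"
  \<comment> \<open>Regard \<open>u\<close> as a function independent of time; any time will do.\<close>
  obtain t where t: "t \<in> times_from T"
    using assms(5) by (cases T) (auto simp: times_from_def)
  have "bounded {x. u x \<noteq> 0}"
    by (rule bounded_subset[OF compact_imp_bounded[OF supp] closure_subset])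
  then obtain R where R: "\<And>x. u x \<noteq> 0 \<Longrightarrow> norm x \<le> R"
    by (auto simp: bounded_iff)
  have "holder2_seminorm \<alpha> (\<lambda>x. u (snd (t, x)))
          \<le> ennreal N * (SUP s\<in>{t<..}. holder_seminorm \<alpha>
               (\<lambda>x. 0 + second_order_op (a s) (\<lambda>y. u (snd (s, y))) x
                  + first_order_op b\<^sub>0 (\<lambda>y. u (snd (s, y))) x - c\<^sub>0 * u (snd (s, x))))"
  proof (rule estimate_with_drift_and_potential[OF assms(2-4,6,7) t stationary_parabolic_space[OF u]
        stationary_is_time_derivative, where R = "R + 1"])
    show "u (snd (s, x)) = 0" if "R + 1 \<le> norm x" for s :: real and x
      using R[of x] that by fastforce
  qed (auto simp: c locally_bounded_after_def bounded_iff)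
  also have "(SUP s\<in>{t<..}. holder_seminorm \<alpha>
               (\<lambda>x. 0 + second_order_op (a s) (\<lambda>y. u (snd (s, y))) x
                  + first_order_op b\<^sub>0 (\<lambda>y. u (snd (s, y))) x - c\<^sub>0 * u (snd (s, x)))) =
      (SUP s\<in>{t<..}. holder_seminorm \<alpha> (\<lambda>x. second_order_op A u x + first_order_op b\<^sub>0 u x - c\<^sub>0 * u x))"
    using A times_after_mono[OF t] by (intro SUP_cong) auto
  also have "\<dots> = holder_seminorm \<alpha> (\<lambda>x. second_order_op A u x + first_order_op b\<^sub>0 u x - c\<^sub>0 * u x)"
    by simp
  finally show "holder2_seminorm \<alpha> u
             \<le> ennreal N * holder_seminorm \<alpha>
                  (\<lambda>x. second_order_op A u x + first_order_op b\<^sub>0 u x - c\<^sub>0 * u x)"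
    by simp
qed

end
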